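(* Assume that $f$ has the following structure: there are a lower convex approximation $l_f(y;x)$ of $f$ on $Q$ and constants $L>0$, $\delta\ge0$ with $$l_f(y;x)\le f(x)\le l_f(y;x)+\frac{L}2\|x-y\|^2+\delta\qquad\forall x,y\in Q .$$ (a) Any sequence $\{(z_{k-1},x_k,\hat x_k)\}_{k\ge0}$ generated by the Classical Gradient Method (CGM) with $\lambda_k:=1$ and $\beta_k:=L/\sigma$ satisfies $$\forall k\ge0,\quad f(\hat x_k)-f(x^* )\le\frac1{k+1}\sum_{i=0}^kf(x_{i+1})-f(x^* )\le\frac{Ll_d(z_k;x^* )}{\sigma(k+1)}+\delta$$ and, for all $k\ge-1$, the points $z_k$, $x_{k+1}$ and (if $k\ge0$) $\hat x_k$ belong to $$\left\{x\in Q:\ \|x-x^*\|^2\le\frac{2d(x^* )}\sigma+\frac{2\delta}L(k+1)\right\}.$$ (b) Any sequence $\{(z_{k-1},x_k,\hat x_k)\}_{k\ge0}$ generated by the Fast Gradient Method (FGM) with $\lambda_k:=\frac{k+1}2$ and $\beta_k:=L/\sigma$ satisfies $$\forall k\ge0,\quad f(\hat x_k)-f(x^* )\le\frac{4Ll_d(z_k;x^* )}{\sigma(k+1)(k+2)}+\frac{k+3}3\delta$$ and, for all $k\ge-1$, the points $z_k$, $x_{k+1}$ and (if $k\ge0$) $\hat x_k$ belong to $$\left\{x\in Q:\ \|x-x^*\|^2\le\frac{2d(x^* )}\sigma+\frac{\delta}{6L}(k+1)(k+2)(k+3)\right\}.$$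
   Context: $E$ is a finite-dimensional real vector space with norm $\|\cdot\|$, $E^*$ its dual, $\langle s,x\rangle$ the value of $s\in E^*$ at $x\in E$. $Q\subset E$ is a nonempty closed convex (possibly unbounded) set, and $f:E\to\mathbb{R}\cup\{+\infty\}$ is a proper lower semicontinuous convex function with $Q\subset\operatorname{dom} f$. The problem $\min_{x\in Q}f(x)$ is assumed to have an optimal solution $x^*\in Q$. Prox-function: $d:E\to\mathbb{R}\cup\{+\infty\}$ is a fixed proper lower semicontinuous convex function which is continuously differentiable on $Q$ (in particular finite on $Q$) and strongly convex on $Q$ with parameter $\sigma>0$, i.e. $d(\tau x+(1-\tau)y)\le \tau d(x)+(1-\tau)d(y)-\frac12\sigma\tau(1-\tau)\|x-y\|^2$ for all $x,y\in Q$, $\tau\in[0,1]$. Put $x_0:=\operatorname{argmin}_{x\in Q}d(x)$; it is assumed that $d(x_0)=0$. For $y\in Q$, $l_d(y;x):=d(y)+\langle\nabla d(y),x-y\rangle$. A lower convex approximation of $f$ on $Q$ is a family of proper lower semicontinuous convex functions $l_f(y;\cdot):E\to\mathbb{R}\cup\{+\infty\}$, $y\in Q$, with $f(x)\ge l_f(y;x)$ for all $x\in Q$. Weight parameters: $\lambda_k>0$ for $k\ge0$; $S_k:=\sum_{i=0}^k\lambda_i$. Scaling parameters: $\beta_k\ge\beta_{k-1}>0$ for $k\ge 0$ (indexed from $k=-1$). Property 1. Auxiliary functions $\psi_k$ ($k\ge-1$), where $\psi_k$ is determined by $\{\lambda_i\}_{i=0}^k,\{\beta_i\}_{i=-1}^k,\{x_i\}_{i=0}^k,\{z_i\}_{i=0}^{k-1}$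 and has a unique minimizer $z_k:=\operatorname{argmin}_{x\in Q}\psi_k(x)$ on $Q$, satisfy Property 1 (for test points $\{x_k\}_{k\ge0}\subset Q$, whose first element is $x_0=\operatorname{argmin}_{x\in Q}d(x)$) if: (i) $\min_{x\in Q}\psi_{-1}(x)=0$ and $z_{-1}=x_0$; (ii) for every $k\ge-1$ and $x\in Q$, $\psi_{k+1}(x)\ge\min_{z\in Q}\psi_k(z)+\lambda_{k+1}l_f(x_{k+1};x)+\beta_{k+1}d(x)-\beta_k l_d(z_k;x)$; (iii) for every $k\ge0$, $\min_{x\in Q}\psi_k(x)\le\inf_{x\in Q}\{\sum_{i=0}^k\lambda_i l_f(x_i;x)+\beta_k l_d(z_k;x)\}$. Standard construction: $\psi_{-1}:=\beta_{-1}d$ and, for each $k\ge-1$, $\psi_{k+1}$ is given by either the extended Mirror-Descent model $\psi_{k+1}(x):=\min_{z\in Q}\psi_k(z)+\lambda_{k+1}l_f(x_{k+1};x)+\beta_{k+1}d(x)-\beta_kl_d(z_k;x)$ or the Dual-Averaging model $\psi_{k+1}(x):=\psi_k(x)+\lambda_{k+1}l_f(x_{k+1};x)+\beta_{k+1}d(x)-\beta_kd(x)$ (free choice for each $k$). In both methods below, $\{\psi_k\}_{k\ge-1}$ is defined by the standard construction or by any construction satisfying Property 1. CGM: for $k\ge0$, $x_k:=z_{k-1}:=\operatorname{argmin}_{x\in Q}\psi_{k-1}(x)$ and $\hat x_k:=\frac1{S_k}\sum_{i=0}^k\lambda_ix_{i+1}$. FGM: $x_0:=z_{-1}:=\operatorname{argmin}_{x\in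 Q}d(x)$, $\hat x_0:=z_0:=\operatorname{argmin}_{x\in Q}\psi_0(x)$, and for $k\ge0$: $x_{k+1}:=\frac{\sum_{i=0}^k\lambda_iz_i+\lambda_{k+1}z_k}{S_{k+1}}$, $z_{k+1}:=\operatorname{argmin}_{x\in Q}\psi_{k+1}(x)$, $\hat x_{k+1}:=\frac1{S_{k+1}}\sum_{i=0}^{k+1}\lambda_iz_i$. *)

theory Defs
  imports "HOL-Analysis.Analysis"
begin

(* Functions into \<real> \<union> {+\<infinity>} are ereal-valued functions satisfying proper_fun, which excludes
   the value -\<infinity>. *)

definition proper_fun :: "('a \<Rightarrow> ereal) \<Rightarrow> bool" where
  "proper_fun g \<longleftrightarrow> (\<forall>x. g x \<noteq> -\<infinity>) \<and> (\<exists>x. g x \<noteq> \<infinity>)"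

definition lsc_fun :: "('a::topological_space \<Rightarrow> ereal) \<Rightarrow> bool" where
  "lsc_fun g \<longleftrightarrow> (\<forall>x. g x \<le> Liminf (at x) g)"

definition convex_fun :: "('a::real_vector \<Rightarrow> ereal) \<Rightarrow> bool" where
  "convex_fun g \<longleftrightarrow> (\<forall>x y. \<forall>t\<in>{0..1::real}.
     g (t *\<^sub>R x + (1 - t) *\<^sub>R y) \<le> ereal t * g x + ereal (1 - t) * g y)"

definition strongly_convex_on :: "'a::real_normed_vector set \<Rightarrow> real \<Rightarrow> ('a \<Rightarrow> ereal) \<Rightarrow> bool" where
  "strongly_convex_on Q \<sigma> g \<longleftrightarrow> (\<forall>x\<in>Q. \<forall>y\<in>Q. \<forall>t\<in>{0..1::real}.
     g (t *\<^sub>R x + (1 - t) *\<^sub>R y)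
       \<le> ereal t * g x + ereal (1 - t) * g y - ereal (\<sigma> / 2 * t * (1 - t) * (norm (x - y))\<^sup>2))"

(* G is a gradient of g along Q, with values in the dual space. Differentiability is relative to Q,
   since Q may have empty interior and g may be +\<infinity> arbitrarily close to points of Q. G y may then
   fail to be unique, but for convex Q its values on the directions x - y with x \<in> Q are unique. *)
definition continuously_differentiable_on ::
  "'a::real_normed_vector set \<Rightarrow> ('a \<Rightarrow> ereal) \<Rightarrow> ('a \<Rightarrow> ('a \<Rightarrow>\<^sub>L real)) \<Rightarrow> bool" where
  "continuously_differentiable_on Q g G \<longleftrightarrow>
     (\<forall>y\<in>Q. \<bar>g y\<bar> \<noteq> \<infinity>) \<and>
     (\<forall>y\<in>Q. ((\<lambda>x. real_of_ereal (g x)) has_derivative blinfun_apply (G y)) (at y within Q)) \<and>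
     continuous_on Q G"

definition is_argmin_on :: "'a set \<Rightarrow> ('a \<Rightarrow> ereal) \<Rightarrow> 'a \<Rightarrow> bool" where
  "is_argmin_on Q g z \<longleftrightarrow> is_arg_min g (\<lambda>x. x \<in> Q) z"

definition linearization ::
  "('a::real_normed_vector \<Rightarrow> ereal) \<Rightarrow> ('a \<Rightarrow> ('a \<Rightarrow>\<^sub>L real)) \<Rightarrow> 'a \<Rightarrow> 'a \<Rightarrow> real" where
  "linearization d G y x = real_of_ereal (d y) + blinfun_apply (G y) (x - y)"

definition lower_convex_approximation ::
  "'a::real_normed_vector set \<Rightarrow> ('a \<Rightarrow> ereal) \<Rightarrow> ('a \<Rightarrow> 'a \<Rightarrow> ereal) \<Rightarrow> bool" where
  "lower_convex_approximation Q f lf \<longleftrightarrow>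
     (\<forall>y\<in>Q. proper_fun (lf y) \<and> lsc_fun (lf y) \<and> convex_fun (lf y) \<and> (\<forall>x\<in>Q. lf y x \<le> f x))"

(* Sequences are indexed by int because \<beta>, \<psi> and z start at index -1; entries below the first
   meaningful index are never constrained. *)

definition weight_sum :: "(int \<Rightarrow> real) \<Rightarrow> int \<Rightarrow> real" where
  "weight_sum lam k = (\<Sum>i=0..k. lam i)"

(* min over Q is written as the infimum; it is attained at z k. *)
definition property1 ::
  "'a::real_normed_vector set \<Rightarrow> ('a \<Rightarrow> ereal) \<Rightarrow> ('a \<Rightarrow> ('a \<Rightarrow>\<^sub>L real)) \<Rightarrow> ('a \<Rightarrow> 'a \<Rightarrow> ereal) \<Rightarrow>
   (int \<Rightarrow> real) \<Rightarrow> (int \<Rightarrow> real) \<Rightarrow> (int \<Rightarrow> 'a \<Rightarrow> ereal) \<Rightarrow> (int \<Rightarrow> 'a) \<Rightarrow> (int \<Rightarrow> 'a) \<Rightarrow> bool" where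
  "property1 Q d G lf lam \<beta> \<psi> z x \<longleftrightarrow>
     is_argmin_on Q d (x 0) \<and>
     (\<forall>k\<ge>-1. \<forall>u. is_argmin_on Q (\<psi> k) u \<longleftrightarrow> u = z k) \<and>
     (INF u\<in>Q. \<psi> (-1) u) = 0 \<and> z (-1) = x 0 \<and>
     (\<forall>k\<ge>-1. \<forall>u\<in>Q. \<psi> (k + 1) u \<ge>
        (INF v\<in>Q. \<psi> k v) + ereal (lam (k + 1)) * lf (x (k + 1)) u
          + ereal (\<beta> (k + 1)) * d u - ereal (\<beta> k * linearization d G (z k) u)) \<and>
     (\<forall>k\<ge>0. (INF u\<in>Q. \<psi> k u) \<le>
        (INF u\<in>Q. (\<Sum>i=0..k. ereal (lam i) * lf (x i) u) + ereal (\<beta> k * linearization d G (z k) u)))"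

(* The recursions are imposed only on Q: off Q the right-hand sides may be \<infinity> - \<infinity>, and only
   minimizers over Q are ever used. *)

definition mirror_descent_step ::
  "'a::real_normed_vector set \<Rightarrow> ('a \<Rightarrow> ereal) \<Rightarrow> ('a \<Rightarrow> ('a \<Rightarrow>\<^sub>L real)) \<Rightarrow> ('a \<Rightarrow> 'a \<Rightarrow> ereal) \<Rightarrow>
   (int \<Rightarrow> real) \<Rightarrow> (int \<Rightarrow> real) \<Rightarrow> (int \<Rightarrow> 'a \<Rightarrow> ereal) \<Rightarrow> (int \<Rightarrow> 'a) \<Rightarrow> (int \<Rightarrow> 'a) \<Rightarrow> int \<Rightarrow> bool" where
  "mirror_descent_step Q d G lf lam \<beta> \<psi> z x k \<longleftrightarrow> (\<forall>u\<in>Q. \<psi> (k + 1) u =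
     (INF v\<in>Q. \<psi> k v) + ereal (lam (k + 1)) * lf (x (k + 1)) u
       + ereal (\<beta> (k + 1)) * d u - ereal (\<beta> k * linearization d G (z k) u))"

definition dual_averaging_step ::
  "'a::real_normed_vector set \<Rightarrow> ('a \<Rightarrow> ereal) \<Rightarrow> ('a \<Rightarrow> 'a \<Rightarrow> ereal) \<Rightarrow>
   (int \<Rightarrow> real) \<Rightarrow> (int \<Rightarrow> real) \<Rightarrow> (int \<Rightarrow> 'a \<Rightarrow> ereal) \<Rightarrow> (int \<Rightarrow> 'a) \<Rightarrow> int \<Rightarrow> bool" where
  "dual_averaging_step Q d lf lam \<beta> \<psi> x k \<longleftrightarrow> (\<forall>u\<in>Q. \<psi> (k + 1) u =
     \<psi> k u + ereal (lam (k + 1)) * lf (x (k + 1)) u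
       + ereal (\<beta> (k + 1)) * d u - ereal (\<beta> k) * d u)"

definition standard_construction ::
  "'a::real_normed_vector set \<Rightarrow> ('a \<Rightarrow> ereal) \<Rightarrow> ('a \<Rightarrow> ('a \<Rightarrow>\<^sub>L real)) \<Rightarrow> ('a \<Rightarrow> 'a \<Rightarrow> ereal) \<Rightarrow>
   (int \<Rightarrow> real) \<Rightarrow> (int \<Rightarrow> real) \<Rightarrow> (int \<Rightarrow> 'a \<Rightarrow> ereal) \<Rightarrow> (int \<Rightarrow> 'a) \<Rightarrow> (int \<Rightarrow> 'a) \<Rightarrow> bool" where
  "standard_construction Q d G lf lam \<beta> \<psi> z x \<longleftrightarrow>
     (\<forall>u\<in>Q. \<psi> (-1) u = ereal (\<beta> (-1)) * d u) \<and>
     (\<forall>k\<ge>-1. mirror_descent_step Q d G lf lam \<beta> \<psi> z x k \<or> dual_averaging_step Q d lf lam \<beta> \<psi> x k)"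

definition auxiliary_functions ::
  "'a::real_normed_vector set \<Rightarrow> ('a \<Rightarrow> ereal) \<Rightarrow> ('a \<Rightarrow> ('a \<Rightarrow>\<^sub>L real)) \<Rightarrow> ('a \<Rightarrow> 'a \<Rightarrow> ereal) \<Rightarrow>
   (int \<Rightarrow> real) \<Rightarrow> (int \<Rightarrow> real) \<Rightarrow> (int \<Rightarrow> 'a \<Rightarrow> ereal) \<Rightarrow> (int \<Rightarrow> 'a) \<Rightarrow> (int \<Rightarrow> 'a) \<Rightarrow> bool" where
  "auxiliary_functions Q d G lf lam \<beta> \<psi> z x \<longleftrightarrow>
     standard_construction Q d G lf lam \<beta> \<psi> z x \<or> property1 Q d G lf lam \<beta> \<psi> z x"

definition classical_gradient_method ::
  "'a::real_normed_vector set \<Rightarrow> ('a \<Rightarrow> ereal) \<Rightarrow> ('a \<Rightarrow> ('a \<Rightarrow>\<^sub>L real)) \<Rightarrow> ('a \<Rightarrow> 'a \<Rightarrow> ereal) \<Rightarrow>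
   (int \<Rightarrow> real) \<Rightarrow> (int \<Rightarrow> real) \<Rightarrow> (int \<Rightarrow> 'a \<Rightarrow> ereal) \<Rightarrow>
   (int \<Rightarrow> 'a) \<Rightarrow> (int \<Rightarrow> 'a) \<Rightarrow> (int \<Rightarrow> 'a) \<Rightarrow> bool" where
  "classical_gradient_method Q d G lf lam \<beta> \<psi> z x xh \<longleftrightarrow>
     auxiliary_functions Q d G lf lam \<beta> \<psi> z x \<and>
     (\<forall>k\<ge>-1. is_argmin_on Q (\<psi> k) (z k)) \<and>
     (\<forall>k\<ge>0. x k = z (k - 1)) \<and>
     (\<forall>k\<ge>0. xh k = (1 / weight_sum lam k) *\<^sub>R (\<Sum>i=0..k. lam i *\<^sub>R x (i + 1)))"

definition fast_gradient_method ::
  "'a::real_normed_vector set \<Rightarrow> ('a \<Rightarrow> ereal) \<Rightarrow> ('a \<Rightarrow> ('a \<Rightarrow>\<^sub>L real)) \<Rightarrow> ('a \<Rightarrow> 'a \<Rightarrow> ereal) \<Rightarrow>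
   (int \<Rightarrow> real) \<Rightarrow> (int \<Rightarrow> real) \<Rightarrow> (int \<Rightarrow> 'a \<Rightarrow> ereal) \<Rightarrow>
   (int \<Rightarrow> 'a) \<Rightarrow> (int \<Rightarrow> 'a) \<Rightarrow> (int \<Rightarrow> 'a) \<Rightarrow> bool" where
  "fast_gradient_method Q d G lf lam \<beta> \<psi> z x xh \<longleftrightarrow>
     auxiliary_functions Q d G lf lam \<beta> \<psi> z x \<and>
     is_argmin_on Q d (z (-1)) \<and> x 0 = z (-1) \<and>
     is_argmin_on Q (\<psi> 0) (z 0) \<and> xh 0 = z 0 \<and>
     (\<forall>k\<ge>0. x (k + 1) =
        (1 / weight_sum lam (k + 1)) *\<^sub>R ((\<Sum>i=0..k. lam i *\<^sub>R z i) + lam (k + 1) *\<^sub>R z k)) \<and>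
     (\<forall>k\<ge>0. is_argmin_on Q (\<psi> (k + 1)) (z (k + 1))) \<and>
     (\<forall>k\<ge>0. xh (k + 1) = (1 / weight_sum lam (k + 1)) *\<^sub>R (\<Sum>i=0..k+1. lam i *\<^sub>R z i))"

end

theory Submission
  imports Defs
begin

text \<open>Let m k be the minimum of the k-th auxiliary function. Two facts about these minima carry the
  proof. An upper bound: m k is at most the weighted sum of the models plus L / \<sigma> times the tangent
  of the prox-function at z k, both at any point of Q. At xs the models are below the optimal value.
  A growth bound: the (k+1)-st auxiliary function exceeds m k by at least the new weighted model plus L / \<sigma>
  times the difference of the prox-function and its tangent at z k. By strong convexity and the scaling
  L / \<sigma>, that difference contributes at least half of L times the squared step from z k to
  z (k + 1), which is what the upper estimate of f by its model costs beside \<delta>.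

  Hence each step of a method pays for the new function value up to an error. In the classical method the
  error is \<delta> per step. In the fast method the test point is chosen such that the new mean differs
  from it by the step scaled by lam / S, and lam^2 \<le> S makes the growth sufficient for S times the
  quadratic error of the model; what is left is S * \<delta>. By induction, the weighted function values
  are bounded by m k plus the accumulated errors (classical_gradient_minimal_value and
  fast_gradient_minimal_value). Together with the upper bound of m k at xs this is the convergence rate
  (minimal_value_gap).

  As function values are at least the optimal value, the same estimate bounds the tangent of the
  prox-function at xs from below, and strong convexity turns this into a bound on the distance from z k
  to xs (minimizer_distance). The other points are convex combinations of the z i, and the radii
  increase.

  Both facts about m k are part of the property required of general auxiliary functions, except for the
  upper bound at k = -1, which is the optimality of the starting point. In the standard
  construction they follow from the optimality condition at z k
  (standard_construction_decomposition).\<close>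

section \<open>Convexity along a set\<close>

definition tangent ::
  "('a::real_normed_vector \<Rightarrow> real) \<Rightarrow> ('a \<Rightarrow> ('a \<Rightarrow>\<^sub>L real)) \<Rightarrow> 'a \<Rightarrow> 'a \<Rightarrow> real" where
  "tangent D G y u = D y + blinfun_apply (G y) (u - y)"

text \<open>A derivative relative to a convex set determines the directional derivatives towards points of
  the set, even if the set has empty interior and the derivative itself is not unique.\<close>

lemma directional_derivative_within:
  fixes D :: "'a::real_normed_vector \<Rightarrow> real"
  assumes "convex Q" "y \<in> Q" "u \<in> Q" and D: "(D has_derivative D') (at y within Q)"
  shows "((\<lambda>t. (D ((1 - t) *\<^sub>R y + t *\<^sub>R u) - D y) / t) \<longlongrightarrow> D' (u - y)) (at 0 within {0..1})"
proof -
  define p where "p t = (1 - t) *\<^sub>R y + t *\<^sub>R u" for t :: real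
  have p_alt: "p = (\<lambda>t. y + t *\<^sub>R (u - y))"
    by (auto simp: p_def algebra_simps)
  have "(p has_derivative (\<lambda>t. t *\<^sub>R (u - y))) (at 0 within {0..1})"
    unfolding p_alt by (auto intro!: derivative_eq_intros)
  moreover have "p ` {0..1} \<subseteq> Q"
    using assms(1-3) by (auto simp: p_def intro: convexD)
  moreover have "p 0 = y"
    by (simp add: p_def)
  ultimately have "((\<lambda>t. D (p t)) has_derivative (\<lambda>t. D' (t *\<^sub>R (u - y)))) (at 0 within {0..1})"
    using has_derivative_in_compose[of p _ 0 "{0..1}" D D'] has_derivative_subset[OF D] by simp
  moreover have "D' (t *\<^sub>R (u - y)) = D' (u - y) * t" for t
    using has_derivative_bounded_linear[OF D] by (simp add: linear_simps)
  ultimately have "((\<lambda>t. D (p t)) has_field_derivative D' (u - y)) (at 0 within {0..1})"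
    by (simp add: has_field_derivative_def)
  then show ?thesis
    using \<open>p 0 = y\<close> by (simp add: has_field_derivative_iff p_def)
qed

lemma nontrivial_at_0_within_unit_interval: "at (0::real) within {0..1} \<noteq> bot"
  by (simp add: trivial_limit_within islimpt_Icc)

lemma eventually_at_0_within_unit_interval:
  assumes "\<And>t::real. 0 < t \<Longrightarrow> t \<le> 1 \<Longrightarrow> P t"
  shows "eventually P (at 0 within {0..1})"
  using assms by (auto simp: eventually_at_filter)

text \<open>Strong convexity improves the gradient inequality by a quadratic term: divide its definition by
  the step length and let the step length tend to zero.\<close>

lemma strongly_convex_above_tangent:
  fixes D :: "'a::real_normed_vector \<Rightarrow> real"
  assumes "convex Q" and y: "y \<in> Q" and u: "u \<in> Q"
    and D: "(D has_derivative blinfun_apply (G y)) (at y within Q)"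
    and strong: "\<And>t. 0 \<le> t \<Longrightarrow> t \<le> 1 \<Longrightarrow> D (t *\<^sub>R u + (1 - t) *\<^sub>R y)
      \<le> t * D u + (1 - t) * D y - \<sigma> / 2 * t * (1 - t) * (norm (u - y))\<^sup>2"
  shows "tangent D G y u + \<sigma> / 2 * (norm (u - y))\<^sup>2 \<le> D u"
proof -
  have "blinfun_apply (G y) (u - y) \<le> D u - D y - \<sigma> / 2 * (1 - 0) * (norm (u - y))\<^sup>2"
  proof (rule tendsto_le[OF nontrivial_at_0_within_unit_interval])
    show "((\<lambda>t. D u - D y - \<sigma> / 2 * (1 - t) * (norm (u - y))\<^sup>2) \<longlongrightarrow>
        D u - D y - \<sigma> / 2 * (1 - 0) * (norm (u - y))\<^sup>2) (at 0 within {0..1})"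
      by (intro tendsto_intros)
    show "((\<lambda>t. (D ((1 - t) *\<^sub>R y + t *\<^sub>R u) - D y) / t) \<longlongrightarrow> blinfun_apply (G y) (u - y))
        (at 0 within {0..1})"
      by (rule directional_derivative_within[OF assms(1) y u D])
    show "\<forall>\<^sub>F t in at 0 within {0..1}. (D ((1 - t) *\<^sub>R y + t *\<^sub>R u) - D y) / t
        \<le> D u - D y - \<sigma> / 2 * (1 - t) * (norm (u - y))\<^sup>2"
    proof (rule eventually_at_0_within_unit_interval)
      fix t :: real assume t: "0 < t" "t \<le> 1"
      have "D ((1 - t) *\<^sub>R y + t *\<^sub>R u) - D y
          \<le> (D u - D y - \<sigma> / 2 * (1 - t) * (norm (u - y))\<^sup>2) * t"
        using strong[of t] t by (simp add: algebra_simps)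
      then show "(D ((1 - t) *\<^sub>R y + t *\<^sub>R u) - D y) / t
          \<le> D u - D y - \<sigma> / 2 * (1 - t) * (norm (u - y))\<^sup>2"
        using t by (simp add: pos_divide_le_eq)
    qed
  qed
  then show ?thesis
    by (simp add: tangent_def)
qed

text \<open>The first-order optimality condition for a sum of a convex and a differentiable function: the
  minimizer remains a minimizer when the differentiable part is replaced by its tangent there.\<close>

lemma minimizer_of_linearized_sum:
  fixes D \<phi> :: "'a::real_normed_vector \<Rightarrow> real"
  assumes "convex_on Q \<phi>" and y: "y \<in> Q" and u: "u \<in> Q"
    and D: "(D has_derivative blinfun_apply (G y)) (at y within Q)"
    and \<beta>: "0 \<le> \<beta>"
    and min: "\<And>v. v \<in> Q \<Longrightarrow> \<phi> y + \<beta> * D y \<le> \<phi> v + \<beta> * D v"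
  shows "\<phi> y + \<beta> * D y \<le> \<phi> u + \<beta> * tangent D G y u"
proof -
  have "convex Q"
    using assms(1) by (simp add: convex_on_def)
  have "\<phi> y - \<phi> u \<le> \<beta> * blinfun_apply (G y) (u - y)"
  proof (rule tendsto_le[OF nontrivial_at_0_within_unit_interval])
    show "((\<lambda>t. \<phi> y - \<phi> u) \<longlongrightarrow> \<phi> y - \<phi> u) (at 0 within {0..1})"
      by (rule tendsto_const)
    show "((\<lambda>t. \<beta> * ((D ((1 - t) *\<^sub>R y + t *\<^sub>R u) - D y) / t)) \<longlongrightarrow> \<beta> * blinfun_apply (G y) (u - y))
        (at 0 within {0..1})"
      by (intro tendsto_mult_left directional_derivative_within[OF \<open>convex Q\<close> y u D])
    show "\<forall>\<^sub>F t in at 0 within {0..1}.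
        \<phi> y - \<phi> u \<le> \<beta> * ((D ((1 - t) *\<^sub>R y + t *\<^sub>R u) - D y) / t)"
    proof (rule eventually_at_0_within_unit_interval)
      fix t :: real assume t: "0 < t" "t \<le> 1"
      let ?v = "(1 - t) *\<^sub>R y + t *\<^sub>R u"
      have "?v \<in> Q"
        using \<open>convex Q\<close> y u t by (auto intro: convexD)
      moreover have "\<phi> ?v \<le> (1 - t) * \<phi> y + t * \<phi> u"
        using convex_onD[OF assms(1)] y u t by simp
      ultimately have "(\<phi> y - \<phi> u) * t \<le> \<beta> * (D ?v - D y)"
        using min[of ?v] by (simp add: algebra_simps)
      then show "\<phi> y - \<phi> u \<le> \<beta> * ((D ?v - D y) / t)"
        using t by (simp add: pos_le_divide_eq)
    qed
  qed
  then show ?thesis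
    by (simp add: tangent_def algebra_simps)
qed

lemma convex_on_affine:
  fixes h :: "'a::real_normed_vector \<Rightarrow>\<^sub>L real"
  assumes "convex Q"
  shows "convex_on Q (\<lambda>u. c + b * blinfun_apply h (u - y))"
  by (rule convex_onI) (use assms in \<open>auto simp: blinfun.bilinear_simps algebra_simps\<close>)

lemma convex_ball_around:
  assumes "convex Q"
  shows "convex {u\<in>Q. (norm (u - a))\<^sup>2 \<le> r}"
proof -
  have "(norm (u - a))\<^sup>2 \<le> r \<longleftrightarrow> u \<in> cball a (sqrt r)" for u
    using real_sqrt_le_iff[of "(norm (u - a))\<^sup>2" r] by (simp add: dist_norm norm_minus_commute)
  then have "{u\<in>Q. (norm (u - a))\<^sup>2 \<le> r} = Q \<inter> cball a (sqrt r)"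
    by blast
  then show ?thesis
    using assms by (simp add: convex_Int)
qed

lemma weighted_mean_in_convex:
  fixes y :: "int \<Rightarrow> 'a::real_vector"
  assumes "convex C" "\<And>i. 0 \<le> i \<Longrightarrow> i \<le> k \<Longrightarrow> 0 \<le> lam i" "\<And>i. 0 \<le> i \<Longrightarrow> i \<le> k \<Longrightarrow> y i \<in> C"
    and W: "0 < weight_sum lam k"
  shows "(1 / weight_sum lam k) *\<^sub>R (\<Sum>i=0..k. lam i *\<^sub>R y i) \<in> C"
proof -
  have "(\<Sum>i=0..k. (lam i / weight_sum lam k) *\<^sub>R y i) \<in> C"
  proof (rule convex_sum)
    show "(\<Sum>i=0..k. lam i / weight_sum lam k) = 1"
      using W unfolding weight_sum_def by (simp flip: sum_divide_distrib)
  qed (use assms in auto)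
  then show ?thesis
    by (simp add: scaleR_sum_right)
qed

lemma sum_atLeastAtMost_int_Suc:
  fixes g :: "int \<Rightarrow> 'b::comm_monoid_add"
  assumes "- 1 \<le> k"
  shows "(\<Sum>i=0..k+1. g i) = (\<Sum>i=0..k. g i) + g (k + 1)"
proof -
  have "{0..k+1} = insert (k + 1) {0..k}"
    using assms by auto
  then show ?thesis
    by (simp add: add.commute)
qed

lemma weight_sum_Suc: "- 1 \<le> k \<Longrightarrow> weight_sum lam (k + 1) = weight_sum lam k + lam (k + 1)"
  by (simp add: weight_sum_def sum_atLeastAtMost_int_Suc)

lemma weight_sum_pos: "0 \<le> k \<Longrightarrow> (\<And>i. 0 \<le> i \<Longrightarrow> 0 < lam i) \<Longrightarrow> 0 < weight_sum lam k"
  by (auto simp: weight_sum_def intro!: sum_pos)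

text \<open>The test point of the accelerated method is the next weighted mean, with the newest point repeated
  in place of the one that is still unknown.\<close>

lemma test_point_in_convex:
  fixes z :: "int \<Rightarrow> 'a::real_vector"
  assumes "convex C" and k: "-1 \<le> k" and lam: "\<And>i. 0 \<le> i \<Longrightarrow> 0 < lam i"
    and z: "\<And>i. -1 \<le> i \<Longrightarrow> i \<le> k \<Longrightarrow> z i \<in> C"
  shows "(1 / weight_sum lam (k + 1)) *\<^sub>R ((\<Sum>i=0..k. lam i *\<^sub>R z i) + lam (k + 1) *\<^sub>R z k) \<in> C"
proof -
  define y where "y i = (if i \<le> k then z i else z k)" for i
  have "(1 / weight_sum lam (k + 1)) *\<^sub>R (\<Sum>i=0..k+1. lam i *\<^sub>R y i) \<in> C"
    using k lam z by (intro weighted_mean_in_convex assms(1))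
      (auto simp: y_def less_imp_le intro: weight_sum_pos)
  also have "(\<Sum>i=0..k+1. lam i *\<^sub>R y i) = (\<Sum>i=0..k. lam i *\<^sub>R z i) + lam (k + 1) *\<^sub>R z k"
    using k by (simp add: sum_atLeastAtMost_int_Suc y_def)
  finally show ?thesis .
qed

section \<open>Estimate sequences\<close>

text \<open>The number m k stands for the minimum of the k-th auxiliary function, attained at z k. Growth is
  recorded only at the next minimizer, where the auxiliary function takes the value m (k + 1). For
  k = -1 the last inequality says that the tangent at the start, scaled by \<beta> (-1), is nonnegative on Q.\<close>

definition estimate_sequence ::
  "'a::real_normed_vector set \<Rightarrow> ('a \<Rightarrow> real) \<Rightarrow> ('a \<Rightarrow> ('a \<Rightarrow>\<^sub>L real)) \<Rightarrow> ('a \<Rightarrow> 'a \<Rightarrow> real) \<Rightarrow>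
   (int \<Rightarrow> real) \<Rightarrow> (int \<Rightarrow> real) \<Rightarrow> (int \<Rightarrow> real) \<Rightarrow> (int \<Rightarrow> 'a) \<Rightarrow> (int \<Rightarrow> 'a) \<Rightarrow> bool" where
  "estimate_sequence Q D G l lam \<beta> m z x \<longleftrightarrow>
     m (-1) = 0 \<and> (\<forall>k\<ge>-1. z k \<in> Q) \<and> (\<forall>k\<ge>0. x k \<in> Q) \<and>
     (\<forall>k\<ge>-1. m k + lam (k + 1) * l (x (k + 1)) (z (k + 1))
        + \<beta> (k + 1) * D (z (k + 1)) - \<beta> k * tangent D G (z k) (z (k + 1)) \<le> m (k + 1)) \<and>
     (\<forall>k\<ge>-1. \<forall>u\<in>Q. m k \<le> (\<Sum>i=0..k. lam i * l (x i) u) + \<beta> k * tangent D G (z k) u)"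

lemma is_argmin_on_iff: "is_argmin_on Q g z \<longleftrightarrow> z \<in> Q \<and> (\<forall>u\<in>Q. g z \<le> g u)"
  by (auto simp: is_argmin_on_def is_arg_min_linorder)

lemma INF_eq_argmin:
  assumes "is_argmin_on Q g z"
  shows "(INF u\<in>Q. g u) = g z"
proof (rule antisym)
  show "(INF u\<in>Q. g u) \<le> g z"
    using assms by (intro INF_lower) (simp add: is_argmin_on_iff)
  show "g z \<le> (INF u\<in>Q. g u)"
    using assms by (intro INF_greatest) (simp add: is_argmin_on_iff)
qed

locale convex_model =
  fixes Q :: "'a::real_normed_vector set"
    and D :: "'a \<Rightarrow> real" and G :: "'a \<Rightarrow> ('a \<Rightarrow>\<^sub>L real)" and l :: "'a \<Rightarrow> 'a \<Rightarrow> real"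
  assumes convex_Q: "convex Q"
    and D_deriv: "\<And>y. y \<in> Q \<Longrightarrow> (D has_derivative blinfun_apply (G y)) (at y within Q)"
    and l_convex: "\<And>y. y \<in> Q \<Longrightarrow> convex_on Q (l y)"
begin

lemma tangent_at_minimizer_nonneg:
  assumes "z \<in> Q" "\<And>u. u \<in> Q \<Longrightarrow> D z \<le> D u" "D z = 0" "u \<in> Q"
  shows "0 \<le> tangent D G z u"
  using minimizer_of_linearized_sum[of Q "\<lambda>_. 0" z u D G 1] assms convex_Q D_deriv
  by (simp add: convex_on_def)

text \<open>The invariant: on Q each auxiliary function is a convex minorant of the weighted models plus the
  scaled prox-function. A dual-averaging step adds a model to the minorant. A mirror-descent step
  replaces the minorant by an affine function before that, and the optimality condition at the
  minimizer says that this affine function lies below the minorant which it replaces.\<close>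

lemma standard_construction_decomposition:
  assumes std: "standard_construction Q d G lf lam \<beta> \<psi> z x"
    and d: "\<And>u. u \<in> Q \<Longrightarrow> d u = ereal (D u)"
    and lf: "\<And>y u. y \<in> Q \<Longrightarrow> u \<in> Q \<Longrightarrow> lf y u = ereal (l y u)"
    and z: "\<And>k. k \<ge> -1 \<Longrightarrow> is_argmin_on Q (\<psi> k) (z k)"
    and x: "\<And>k. k \<ge> 0 \<Longrightarrow> x k \<in> Q"
    and lam: "\<And>k. k \<ge> 0 \<Longrightarrow> 0 \<le> lam k" and \<beta>: "\<And>k. k \<ge> -1 \<Longrightarrow> 0 \<le> \<beta> k"
    and "-1 \<le> k"
  shows "\<exists>\<phi>. convex_on Q \<phi> \<and> (\<forall>u\<in>Q. \<psi> k u = ereal (\<phi> u + \<beta> k * D u)) \<and>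
    (\<forall>u\<in>Q. \<phi> u \<le> (\<Sum>i=0..k. lam i * l (x i) u))"
  using \<open>-1 \<le> k\<close>
proof (induction k rule: int_ge_induct)
  case base
  show ?case
    using std d convex_Q
    by (intro exI[of _ "\<lambda>_. 0"]) (auto simp: standard_construction_def convex_on_def)
next
  case (step k)
  then obtain \<phi> where \<phi>: "convex_on Q \<phi>" "\<forall>u\<in>Q. \<psi> k u = ereal (\<phi> u + \<beta> k * D u)"
    "\<forall>u\<in>Q. \<phi> u \<le> (\<Sum>i=0..k. lam i * l (x i) u)" by blast
  let ?m = "\<phi> (z k) + \<beta> k * D (z k)"
  have k: "k \<ge> -1" "k + 1 \<ge> 0" using step by auto
  have zQ: "z k \<in> Q" and "\<And>u. u \<in> Q \<Longrightarrow> ?m \<le> \<phi> u + \<beta> k * D u"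
    using z[OF k(1)] \<phi>(2) by (auto simp: is_argmin_on_iff)
  then have opt: "?m \<le> \<phi> u + \<beta> k * tangent D G (z k) u" if "u \<in> Q" for u
    using minimizer_of_linearized_sum[where G=G and D=D and \<beta>="\<beta> k", OF \<phi>(1) zQ that
        D_deriv[OF zQ]] \<beta>[OF k(1)]
    by blast
  have xQ: "x (k + 1) \<in> Q"
    using x k by simp
  have model: "convex_on Q (\<lambda>u. lam (k + 1) * l (x (k + 1)) u)"
    using lam k xQ l_convex by (intro convex_on_cmul) auto
  have lin: "linearization d G (z k) u = tangent D G (z k) u" for u
    using d zQ by (simp add: linearization_def tangent_def)
  have "mirror_descent_step Q d G lf lam \<beta> \<psi> z x k \<or> dual_averaging_step Q d lf lam \<beta> \<psi> x k"
    using std k by (auto simp: standard_construction_def)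
  then show ?case
  proof
    assume md: "mirror_descent_step Q d G lf lam \<beta> \<psi> z x k"
    define \<phi>' where "\<phi>' u = (?m - \<beta> k * tangent D G (z k) u) + lam (k + 1) * l (x (k + 1)) u" for u
    have "convex_on Q (\<lambda>u. ?m - \<beta> k * tangent D G (z k) u)"
      using convex_on_affine[OF convex_Q, of "?m - \<beta> k * D (z k)" "- \<beta> k" "G (z k)" "z k"]
      by (simp add: tangent_def algebra_simps)
    then have "convex_on Q \<phi>'"
      unfolding \<phi>'_def by (intro convex_on_add model)
    moreover have "\<psi> (k + 1) u = ereal (\<phi>' u + \<beta> (k + 1) * D u)" if "u \<in> Q" for u
      using md that INF_eq_argmin[OF z[OF k(1)]] \<phi>(2) zQ xQ d lf
      by (simp add: mirror_descent_step_def \<phi>'_def lin)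
    moreover have "\<phi>' u \<le> (\<Sum>i=0..k+1. lam i * l (x i) u)" if "u \<in> Q" for u
      using opt[OF that] \<phi>(3) that k unfolding \<phi>'_def
      by (subst sum_atLeastAtMost_int_Suc) force+
    ultimately show ?thesis by blast
  next
    assume da: "dual_averaging_step Q d lf lam \<beta> \<psi> x k"
    define \<phi>' where "\<phi>' u = \<phi> u + lam (k + 1) * l (x (k + 1)) u" for u
    have "convex_on Q \<phi>'"
      unfolding \<phi>'_def by (intro convex_on_add model \<phi>(1))
    moreover have "\<psi> (k + 1) u = ereal (\<phi>' u + \<beta> (k + 1) * D u)" if "u \<in> Q" for u
      using da that \<phi>(2) xQ d lf by (simp add: dual_averaging_step_def \<phi>'_def)
    moreover have "\<phi>' u \<le> (\<Sum>i=0..k+1. lam i * l (x i) u)" if "u \<in> Q" for u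
      using \<phi>(3) that k unfolding \<phi>'_def by (simp add: sum_atLeastAtMost_int_Suc)
    ultimately show ?thesis by blast
  qed
qed

lemma standard_construction_estimate_sequence:
  assumes std: "standard_construction Q d G lf lam \<beta> \<psi> z x"
    and d: "\<And>u. u \<in> Q \<Longrightarrow> d u = ereal (D u)"
    and lf: "\<And>y u. y \<in> Q \<Longrightarrow> u \<in> Q \<Longrightarrow> lf y u = ereal (l y u)"
    and z: "\<And>k. k \<ge> -1 \<Longrightarrow> is_argmin_on Q (\<psi> k) (z k)"
    and x: "\<And>k. k \<ge> 0 \<Longrightarrow> x k \<in> Q"
    and lam: "\<And>k. k \<ge> 0 \<Longrightarrow> 0 \<le> lam k" and \<beta>: "\<And>k. k \<ge> -1 \<Longrightarrow> 0 \<le> \<beta> k"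
    and z0: "D (z (-1)) = 0"
  shows "estimate_sequence Q D G l lam \<beta> (\<lambda>k. real_of_ereal (\<psi> k (z k))) z x"
proof -
  have zQ: "z k \<in> Q" if "k \<ge> -1" for k
    using z[OF that] by (simp add: is_argmin_on_iff)
  have "\<exists>\<phi>. \<forall>k\<ge>-1. convex_on Q (\<phi> k) \<and> (\<forall>u\<in>Q. \<psi> k u = ereal (\<phi> k u + \<beta> k * D u)) \<and>
    (\<forall>u\<in>Q. \<phi> k u \<le> (\<Sum>i=0..k. lam i * l (x i) u))"
    using standard_construction_decomposition[OF std d lf z x lam \<beta>] by metis
  then obtain \<phi> where \<phi>: "\<And>k. k \<ge> -1 \<Longrightarrow> convex_on Q (\<phi> k)"
    "\<And>k u. k \<ge> -1 \<Longrightarrow> u \<in> Q \<Longrightarrow> \<psi> k u = ereal (\<phi> k u + \<beta> k * D u)"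
    "\<And>k u. k \<ge> -1 \<Longrightarrow> u \<in> Q \<Longrightarrow> \<phi> k u \<le> (\<Sum>i=0..k. lam i * l (x i) u)" by blast
  define m where "m k = real_of_ereal (\<psi> k (z k))" for k
  have m: "m k = \<phi> k (z k) + \<beta> k * D (z k)" if "k \<ge> -1" for k
    using \<phi>(2)[OF that zQ[OF that]] by (simp add: m_def)
  have \<psi>z: "\<psi> k (z k) = ereal (m k)" if "k \<ge> -1" for k
    using \<phi>(2)[OF that zQ[OF that]] m[OF that] by simp
  have opt: "m k \<le> \<phi> k u + \<beta> k * tangent D G (z k) u" if k: "k \<ge> -1" and u: "u \<in> Q" for k u
    unfolding m[OF k]
  proof (rule minimizer_of_linearized_sum)
    fix v assume v: "v \<in> Q"
    then have "\<psi> k (z k) \<le> \<psi> k v"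
      using z[OF k] by (simp add: is_argmin_on_iff)
    then show "\<phi> k (z k) + \<beta> k * D (z k) \<le> \<phi> k v + \<beta> k * D v"
      using \<phi>(2)[OF k] zQ[OF k] v by simp
  qed (use \<phi>(1) zQ D_deriv \<beta> k u in auto)
  have "m (-1) = 0"
    using std z0 zQ[of "-1"] d by (simp add: m_def standard_construction_def)
  moreover have "m k + lam (k + 1) * l (x (k + 1)) (z (k + 1)) + \<beta> (k + 1) * D (z (k + 1))
      - \<beta> k * tangent D G (z k) (z (k + 1)) \<le> m (k + 1)" if k: "k \<ge> -1" for k
  proof -
    have zQ': "z k \<in> Q" "z (k + 1) \<in> Q" and xQ: "x (k + 1) \<in> Q"
      using zQ x k by auto
    have lin: "linearization d G (z k) u = tangent D G (z k) u" for u
      using d zQ' by (simp add: linearization_def tangent_def)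
    have "mirror_descent_step Q d G lf lam \<beta> \<psi> z x k \<or> dual_averaging_step Q d lf lam \<beta> \<psi> x k"
      using std k by (auto simp: standard_construction_def)
    then show ?thesis
    proof
      assume "mirror_descent_step Q d G lf lam \<beta> \<psi> z x k"
      then have "\<psi> (k + 1) (z (k + 1)) = ereal (m k + lam (k + 1) * l (x (k + 1)) (z (k + 1))
          + \<beta> (k + 1) * D (z (k + 1)) - \<beta> k * tangent D G (z k) (z (k + 1)))"
        using zQ' xQ d lf INF_eq_argmin[OF z[OF k]] \<psi>z[OF k]
        by (simp add: mirror_descent_step_def lin)
      then show ?thesis
        by (simp add: m_def)
    next
      assume "dual_averaging_step Q d lf lam \<beta> \<psi> x k"
      then have "\<psi> (k + 1) (z (k + 1)) = ereal (\<phi> k (z (k + 1))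
          + lam (k + 1) * l (x (k + 1)) (z (k + 1)) + \<beta> (k + 1) * D (z (k + 1)))"
        using zQ' xQ d lf \<phi>(2)[OF k] by (simp add: dual_averaging_step_def)
      then show ?thesis
        using opt[OF k zQ'(2)] by (simp add: m_def)
    qed
  qed
  moreover have "m k \<le> (\<Sum>i=0..k. lam i * l (x i) u) + \<beta> k * tangent D G (z k) u"
    if "k \<ge> -1" "u \<in> Q" for k u
    using opt[OF that] \<phi>(3)[OF that] by simp
  ultimately show ?thesis
    using zQ x unfolding estimate_sequence_def m_def by blast
qed

text \<open>The inequalities of the property bound each minimal value from above by a real number and, by
  induction, from below as well. So the minimal values are finite, although the auxiliary functions themselves may take infinite values on Q.\<close>

lemma property1_estimate_sequence:
  assumes p1: "property1 Q d G lf lam \<beta> \<psi> z x"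
    and d: "\<And>u. u \<in> Q \<Longrightarrow> d u = ereal (D u)"
    and lf: "\<And>y u. y \<in> Q \<Longrightarrow> u \<in> Q \<Longrightarrow> lf y u = ereal (l y u)"
    and x: "\<And>k. k \<ge> 0 \<Longrightarrow> x k \<in> Q"
    and \<beta>: "0 \<le> \<beta> (-1)"
    and z0: "D (z (-1)) = 0"
  shows "estimate_sequence Q D G l lam \<beta> (\<lambda>k. real_of_ereal (\<psi> k (z k))) z x"
proof -
  have z: "is_argmin_on Q (\<psi> k) (z k)" if "k \<ge> -1" for k
    using p1 that by (auto simp: property1_def)
  then have zQ: "z k \<in> Q" if "k \<ge> -1" for k
    using that by (simp add: is_argmin_on_iff)
  note INF = INF_eq_argmin[OF z]
  have lin: "linearization d G (z k) u = tangent D G (z k) u" if "k \<ge> -1" for k u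
    using d zQ[OF that] by (simp add: linearization_def tangent_def)
  have start: "\<psi> (-1) (z (-1)) = 0"
    using p1 INF[of "-1"] by (auto simp: property1_def)
  have up: "\<psi> k (z k) \<le> ereal ((\<Sum>i=0..k. lam i * l (x i) u) + \<beta> k * tangent D G (z k) u)"
    if k: "k \<ge> 0" and u: "u \<in> Q" for k u
  proof -
    have "(INF u\<in>Q. \<psi> k u) \<le>
        (INF u\<in>Q. (\<Sum>i=0..k. ereal (lam i) * lf (x i) u) + ereal (\<beta> k * linearization d G (z k) u))"
      using p1 k by (simp add: property1_def)
    also have "\<dots> \<le> (\<Sum>i=0..k. ereal (lam i) * lf (x i) u) + ereal (\<beta> k * linearization d G (z k) u)"
      using u by (rule INF_lower)
    also have "(\<Sum>i=0..k. ereal (lam i) * lf (x i) u) = (\<Sum>i=0..k. ereal (lam i * l (x i) u))"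
      using x lf u by (intro sum.cong) auto
    finally show ?thesis
      using INF[of k] lin[of k] k by simp
  qed
  have low: "\<psi> k (z k) + ereal (lam (k + 1) * l (x (k + 1)) (z (k + 1))
      + \<beta> (k + 1) * D (z (k + 1)) - \<beta> k * tangent D G (z k) (z (k + 1))) \<le> \<psi> (k + 1) (z (k + 1))"
    (is "_ + ereal ?c \<le> _") if k: "k \<ge> -1" for k
  proof -
    have zQ': "z (k + 1) \<in> Q" and xQ: "x (k + 1) \<in> Q"
      using zQ x k by auto
    have "(INF v\<in>Q. \<psi> k v) + ereal (lam (k + 1)) * lf (x (k + 1)) (z (k + 1))
          + ereal (\<beta> (k + 1)) * d (z (k + 1)) - ereal (\<beta> k * linearization d G (z k) (z (k + 1)))
        \<le> \<psi> (k + 1) (z (k + 1))"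
      using p1 k zQ' by (simp add: property1_def)
    then show ?thesis
      using lf[OF xQ zQ'] d[OF zQ'] INF[OF k] lin[OF k] by (cases "\<psi> k (z k)") (simp_all add: algebra_simps)
  qed
  have real: "\<psi> k (z k) = ereal (real_of_ereal (\<psi> k (z k)))" if "k \<ge> -1" for k
    using that
  proof (induction k rule: int_ge_induct)
    case base
    show ?case by (simp add: start)
  next
    case (step k)
    have "\<psi> (k + 1) (z (k + 1)) \<noteq> \<infinity>"
      using up[of "k + 1" "z k"] zQ[of k] step by auto
    moreover have "\<psi> (k + 1) (z (k + 1)) \<noteq> -\<infinity>"
      using low[of k] step by (cases "\<psi> k (z k)") auto
    ultimately show ?case
      by (cases "\<psi> (k + 1) (z (k + 1))") auto
  qed
  define m where "m k = real_of_ereal (\<psi> k (z k))" for k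
  note real = real[folded m_def]
  have "m (-1) = 0"
    by (simp add: m_def start)
  moreover have "m k + lam (k + 1) * l (x (k + 1)) (z (k + 1)) + \<beta> (k + 1) * D (z (k + 1))
      - \<beta> k * tangent D G (z k) (z (k + 1)) \<le> m (k + 1)" if k: "k \<ge> -1" for k
    using low[OF k] real[OF k] real[of "k + 1"] k by simp
  moreover have "m k \<le> (\<Sum>i=0..k. lam i * l (x i) u) + \<beta> k * tangent D G (z k) u"
    if k: "k \<ge> -1" and u: "u \<in> Q" for k u
  proof (cases "k = -1")
    case True
    have "is_argmin_on Q d (z (-1))"
      using p1 by (simp add: property1_def)
    then have "0 \<le> tangent D G (z (-1)) u"
      using u d z0 by (intro tangent_at_minimizer_nonneg) (auto simp: is_argmin_on_iff)
    then show ?thesis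
      using True \<beta> \<open>m (-1) = 0\<close> by simp
  next
    case False
    then show ?thesis
      using up[of k u] real[of k] k u by simp
  qed
  ultimately show ?thesis
    using zQ x unfolding estimate_sequence_def m_def by blast
qed

lemma auxiliary_functions_estimate_sequence:
  assumes "auxiliary_functions Q d G lf lam \<beta> \<psi> z x"
    and "\<And>u. u \<in> Q \<Longrightarrow> d u = ereal (D u)"
    and "\<And>y u. y \<in> Q \<Longrightarrow> u \<in> Q \<Longrightarrow> lf y u = ereal (l y u)"
    and "\<And>k. k \<ge> -1 \<Longrightarrow> is_argmin_on Q (\<psi> k) (z k)"
    and "\<And>k. k \<ge> 0 \<Longrightarrow> x k \<in> Q"
    and "\<And>k. k \<ge> 0 \<Longrightarrow> 0 \<le> lam k" and "\<And>k. k \<ge> -1 \<Longrightarrow> 0 \<le> \<beta> k"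
    and "D (z (-1)) = 0"
  shows "estimate_sequence Q D G l lam \<beta> (\<lambda>k. real_of_ereal (\<psi> k (z k))) z x"
  using assms standard_construction_estimate_sequence[of d lf lam \<beta> \<psi> z x]
    property1_estimate_sequence[of d lf lam \<beta> \<psi> z x]
  unfolding auxiliary_functions_def by auto

end

section \<open>Convergence of the gradient methods\<close>

locale inexact_model = convex_model Q D G l
  for Q :: "'a::real_normed_vector set" and D G l +
  fixes F :: "'a \<Rightarrow> real" and \<sigma> L \<delta> :: real and xs :: 'a
  assumes F_convex: "convex_on Q F"
    and xs: "xs \<in> Q" "\<And>u. u \<in> Q \<Longrightarrow> F xs \<le> F u"
    and D_strong: "\<And>u y t. u \<in> Q \<Longrightarrow> y \<in> Q \<Longrightarrow> 0 \<le> t \<Longrightarrow> t \<le> 1 \<Longrightarrow> D (t *\<^sub>R u + (1 - t) *\<^sub>R y)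
      \<le> t * D u + (1 - t) * D y - \<sigma> / 2 * t * (1 - t) * (norm (u - y))\<^sup>2"
    and l_lower: "\<And>y u. y \<in> Q \<Longrightarrow> u \<in> Q \<Longrightarrow> l y u \<le> F u"
    and l_upper: "\<And>y u. y \<in> Q \<Longrightarrow> u \<in> Q \<Longrightarrow> F u \<le> l y u + (L / 2 * (norm (u - y))\<^sup>2 + \<delta>)"
    and pos: "0 < \<sigma>" "0 < L" "0 \<le> \<delta>"
begin

lemma above_tangent:
  assumes "y \<in> Q" "u \<in> Q"
  shows "tangent D G y u + \<sigma> / 2 * (norm (u - y))\<^sup>2 \<le> D u"
  using assms by (intro strongly_convex_above_tangent[where Q=Q] convex_Q D_deriv D_strong)

text \<open>The scaling L / \<sigma> is chosen so that the strong convexity of the prox-function yields the same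
  quadratic term that bounds the error of the model.\<close>

lemma minimal_value_growth:
  assumes es: "estimate_sequence Q D G l lam (\<lambda>_. L / \<sigma>) m z x" and k: "-1 \<le> k"
  shows "m k + lam (k + 1) * l (x (k + 1)) (z (k + 1)) + L / 2 * (norm (z (k + 1) - z k))\<^sup>2
    \<le> m (k + 1)"
proof -
  have "z k \<in> Q" "z (k + 1) \<in> Q"
    using es k by (auto simp: estimate_sequence_def)
  from above_tangent[OF this]
  have "L / \<sigma> * (\<sigma> / 2 * (norm (z (k + 1) - z k))\<^sup>2)
      \<le> L / \<sigma> * (D (z (k + 1)) - tangent D G (z k) (z (k + 1)))"
    using pos by (intro mult_left_mono) auto
  moreover have "m k + lam (k + 1) * l (x (k + 1)) (z (k + 1)) + L / \<sigma> * D (z (k + 1))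
      - L / \<sigma> * tangent D G (z k) (z (k + 1)) \<le> m (k + 1)"
    using es k by (simp add: estimate_sequence_def)
  ultimately show ?thesis
    using pos by (simp add: algebra_simps)
qed

lemma minimal_value_gap:
  assumes es: "estimate_sequence Q D G l lam (\<lambda>_. L / \<sigma>) m z x" and k: "-1 \<le> k"
    and lam: "\<And>k. k \<ge> 0 \<Longrightarrow> 0 \<le> lam k"
    and V: "V \<le> m k + E"
  shows "V - weight_sum lam k * F xs \<le> L / \<sigma> * tangent D G (z k) xs + E"
proof -
  have "m k \<le> (\<Sum>i=0..k. lam i * l (x i) xs) + L / \<sigma> * tangent D G (z k) xs"
    using es k xs(1) by (simp add: estimate_sequence_def)
  moreover have "(\<Sum>i=0..k. lam i * l (x i) xs) \<le> (\<Sum>i=0..k. lam i * F xs)"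
    using es xs(1) lam
    by (intro sum_mono mult_left_mono l_lower) (auto simp: estimate_sequence_def)
  ultimately show ?thesis
    using V by (simp add: weight_sum_def sum_distrib_right)
qed

text \<open>Optimality of xs makes the left side of the gap estimate nonnegative. This bounds the tangent of
  the prox-function from below, and strong convexity turns that into a bound on the distance.\<close>

lemma minimizer_distance:
  assumes es: "estimate_sequence Q D G l lam (\<lambda>_. L / \<sigma>) m z x" and k: "-1 \<le> k"
    and lam: "\<And>k. k \<ge> 0 \<Longrightarrow> 0 \<le> lam k"
    and V: "V \<le> m k + E" "weight_sum lam k * F xs \<le> V"
  shows "(norm (z k - xs))\<^sup>2 \<le> 2 * D xs / \<sigma> + 2 * E / L"
proof -
  have "z k \<in> Q"
    using es k by (simp add: estimate_sequence_def)
  have "0 \<le> L / \<sigma> * tangent D G (z k) xs + E"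
    using minimal_value_gap[OF es k lam V(1)] V(2) by simp
  then have "0 \<le> (L / \<sigma> * tangent D G (z k) xs + E) * (2 / L)"
    using pos by (intro mult_nonneg_nonneg) auto
  also have "\<dots> = tangent D G (z k) xs * (2 / \<sigma>) + 2 * E / L"
    using pos by (simp add: field_simps)
  also have "tangent D G (z k) xs * (2 / \<sigma>) \<le> (D xs - \<sigma> / 2 * (norm (xs - z k))\<^sup>2) * (2 / \<sigma>)"
    using above_tangent[OF \<open>z k \<in> Q\<close> xs(1)] pos by (intro mult_right_mono) auto
  also have "\<dots> = 2 * D xs / \<sigma> - (norm (z k - xs))\<^sup>2"
    using pos by (simp add: field_simps norm_minus_commute)
  finally show ?thesis
    by simp
qed

text \<open>The test point is the previous minimizer, so the growth of the minimal value is at least the upper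
  estimate of F at the new minimizer, less \<delta>.\<close>

lemma classical_gradient_minimal_value:
  assumes es: "estimate_sequence Q D G l (\<lambda>_. 1) (\<lambda>_. L / \<sigma>) m z x" and k: "-1 \<le> k"
    and x: "\<And>k. k \<ge> 0 \<Longrightarrow> x k = z (k - 1)"
  shows "(\<Sum>i=0..k. F (z i)) \<le> m k + (of_int k + 1) * \<delta>"
  using k
proof (induction k rule: int_ge_induct)
  case base
  show ?case
    using es by (simp add: estimate_sequence_def)
next
  case (step k)
  have zQ: "z k \<in> Q" "z (k + 1) \<in> Q"
    using es step by (auto simp: estimate_sequence_def)
  have "F (z (k + 1)) \<le> l (z k) (z (k + 1)) + (L / 2 * (norm (z (k + 1) - z k))\<^sup>2 + \<delta>)"
    by (rule l_upper[OF zQ])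
  moreover have "m k + l (z k) (z (k + 1)) + L / 2 * (norm (z (k + 1) - z k))\<^sup>2 \<le> m (k + 1)"
    using minimal_value_growth[OF es, of k] step x[of "k + 1"] by simp
  moreover have "(\<Sum>i=0..k+1. F (z i)) = (\<Sum>i=0..k. F (z i)) + F (z (k + 1))"
    using step by (simp add: sum_atLeastAtMost_int_Suc)
  ultimately show ?case
    using step by (simp add: distrib_right)
qed

text \<open>One accelerated step. The new mean y differs from the test point x by the displacement of z
  scaled by w / S', so its squared model error carries the factor (w / S')^2. As w^2 \<le> S',
  multiplication by S' leaves at most the quadratic growth of the minimal value. Convexity of the model
  at x combines the old mean and the new z.\<close>

lemma accelerated_step:
  assumes Q: "yo \<in> Q" "zn \<in> Q" "x \<in> Q"
    and S: "0 \<le> S" "0 < S'" "S' = S + w" "0 \<le> w" "w\<^sup>2 \<le> S'"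
    and x: "x = (1 / S') *\<^sub>R (S *\<^sub>R yo + w *\<^sub>R zo)"
    and y: "y = (1 / S') *\<^sub>R (S *\<^sub>R yo + w *\<^sub>R zn)"
  shows "S' * F y \<le> S * F yo + w * l x zn + L / 2 * (norm (zn - zo))\<^sup>2 + S' * \<delta>"
proof -
  have y': "y = (S / S') *\<^sub>R yo + (w / S') *\<^sub>R zn"
    unfolding y by (simp add: scaleR_add_right)
  have one: "S / S' + w / S' = 1"
    using S by (simp flip: add_divide_distrib)
  have nonneg: "0 \<le> S / S'" "0 \<le> w / S'"
    using S by auto
  have yQ: "y \<in> Q"
    unfolding y' using nonneg one Q convex_Q by (intro convexD) auto
  have "l x y \<le> S / S' * l x yo + w / S' * l x zn"
    unfolding y' using l_convex[OF Q(3)] nonneg one Q(1,2) unfolding convex_on_def by blast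
  then have "S' * l x y \<le> S' * (S / S' * l x yo + w / S' * l x zn)"
    using S by (intro mult_left_mono) auto
  also have "\<dots> = S * l x yo + w * l x zn"
    using S(2) by (simp add: distrib_left)
  also have "\<dots> \<le> S * F yo + w * l x zn"
    using S Q l_lower by (intro add_right_mono mult_left_mono) auto
  finally have model: "S' * l x y \<le> S * F yo + w * l x zn" .
  have "y - x = (w / S') *\<^sub>R (zn - zo)"
    unfolding y x by (simp add: scaleR_add_right scaleR_diff_right)
  then have "S' * (norm (y - x))\<^sup>2 = S' * (w / S' * norm (zn - zo))\<^sup>2"
    using S by (simp add: power_mult_distrib)
  also have "\<dots> = w\<^sup>2 / S' * (norm (zn - zo))\<^sup>2"
    using S(2) by (simp add: power2_eq_square)
  also have "\<dots> \<le> 1 * (norm (zn - zo))\<^sup>2"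
    using S by (intro mult_right_mono) auto
  finally have "L / 2 * (S' * (norm (y - x))\<^sup>2) \<le> L / 2 * (norm (zn - zo))\<^sup>2"
    using pos by (intro mult_left_mono) auto
  moreover have "S' * F y \<le> S' * (l x y + (L / 2 * (norm (y - x))\<^sup>2 + \<delta>))"
    using S by (intro mult_left_mono l_upper Q yQ) auto
  ultimately show ?thesis
    using model by (simp add: algebra_simps)
qed

text \<open>Every step adds its own error, the total weight times \<delta>. For linearly growing weights the sum of
  these errors grows faster than the total weight, so the inexactness is amplified.\<close>

lemma fast_gradient_minimal_value:
  assumes es: "estimate_sequence Q D G l lam (\<lambda>_. L / \<sigma>) m z x" and k: "-1 \<le> k"
    and lam: "\<And>k. k \<ge> 0 \<Longrightarrow> 0 < lam k" "\<And>k. k \<ge> 0 \<Longrightarrow> (lam k)\<^sup>2 \<le> weight_sum lam k"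
    and x: "\<And>k. k \<ge> -1 \<Longrightarrow> x (k + 1) =
      (1 / weight_sum lam (k + 1)) *\<^sub>R ((\<Sum>i=0..k. lam i *\<^sub>R z i) + lam (k + 1) *\<^sub>R z k)"
    and xh: "\<And>k. k \<ge> 0 \<Longrightarrow> xh k = (1 / weight_sum lam k) *\<^sub>R (\<Sum>i=0..k. lam i *\<^sub>R z i)"
  shows "weight_sum lam k * F (xh k) \<le> m k + (\<Sum>i=0..k. weight_sum lam i) * \<delta>"
  using k
proof (induction k rule: int_ge_induct)
  case base
  show ?case
    using es by (simp add: estimate_sequence_def weight_sum_def)
next
  case (step k)
  have zQ: "z i \<in> Q" if "i \<ge> -1" for i
    using es that by (auto simp: estimate_sequence_def)
  have S: "0 \<le> weight_sum lam k" and S': "0 < weight_sum lam (k + 1)"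
    using lam(1) step
    by (auto simp: weight_sum_def less_imp_le intro!: sum_nonneg weight_sum_pos[unfolded weight_sum_def])
  \<comment> \<open>At k = -1 the mean has weight 0, and any point of Q can take its place.\<close>
  define yo where "yo = (if k = -1 then z (-1) else xh k)"
  have yo: "weight_sum lam k *\<^sub>R yo = (\<Sum>i=0..k. lam i *\<^sub>R z i)"
  proof (cases "k = -1")
    case False
    then have "0 < weight_sum lam k"
      using lam(1) step by (intro weight_sum_pos) auto
    then show ?thesis
      using xh[of k] step False by (simp add: yo_def)
  qed (simp add: weight_sum_def)
  have yoQ: "yo \<in> Q"
  proof (cases "k = -1")
    case False
    then have "0 < weight_sum lam k"
      using lam(1) step by (intro weight_sum_pos) auto
    then show ?thesis
      using xh[of k] step False zQ lam(1) convex_Q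
      by (auto simp: yo_def less_imp_le intro!: weighted_mean_in_convex)
  qed (simp add: yo_def zQ)
  have "weight_sum lam (k + 1) * F (xh (k + 1)) \<le> weight_sum lam k * F yo
      + lam (k + 1) * l (x (k + 1)) (z (k + 1)) + L / 2 * (norm (z (k + 1) - z k))\<^sup>2
      + weight_sum lam (k + 1) * \<delta>"
  proof (rule accelerated_step)
    show "x (k + 1) \<in> Q"
      using es step by (simp add: estimate_sequence_def)
    show "x (k + 1) = (1 / weight_sum lam (k + 1)) *\<^sub>R (weight_sum lam k *\<^sub>R yo + lam (k + 1) *\<^sub>R z k)"
      using x step yo by simp
    show "xh (k + 1) =
        (1 / weight_sum lam (k + 1)) *\<^sub>R (weight_sum lam k *\<^sub>R yo + lam (k + 1) *\<^sub>R z (k + 1))"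
      using xh[of "k + 1"] step yo by (simp add: sum_atLeastAtMost_int_Suc)
    show "(lam (k + 1))\<^sup>2 \<le> weight_sum lam (k + 1)"
      using lam(2) step by simp
  qed (use S S' yoQ zQ step lam(1) weight_sum_Suc in \<open>auto simp: less_imp_le\<close>)
  moreover have "weight_sum lam k * F yo = weight_sum lam k * F (xh k)"
    by (simp add: yo_def weight_sum_def)
  moreover have "(\<Sum>i=0..k+1. weight_sum lam i) * \<delta>
      = (\<Sum>i=0..k. weight_sum lam i) * \<delta> + weight_sum lam (k + 1) * \<delta>"
    using step by (simp add: sum_atLeastAtMost_int_Suc distrib_right)
  ultimately show ?case
    using step minimal_value_growth[OF es, of k] by linarith
qed


subsection \<open>Rates and bounded trajectories\<close>

lemma weight_sum_one: "-1 \<le> k \<Longrightarrow> weight_sum (\<lambda>_. 1) k = of_int k + 1"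
  by (simp add: weight_sum_def)

lemma classical_gradient_rate:
  assumes es: "estimate_sequence Q D G l (\<lambda>_. 1) (\<lambda>_. L / \<sigma>) m z x" and k: "0 \<le> k"
    and x: "\<And>k. k \<ge> 0 \<Longrightarrow> x k = z (k - 1)"
    and xh: "xh = (1 / weight_sum (\<lambda>_. 1) k) *\<^sub>R (\<Sum>i=0..k. 1 *\<^sub>R x (i + 1))"
  shows "F xh \<le> 1 / (of_int k + 1) * (\<Sum>i=0..k. F (x (i + 1)))"
    and "1 / (of_int k + 1) * (\<Sum>i=0..k. F (x (i + 1))) - F xs
      \<le> L * tangent D G (z k) xs / (\<sigma> * (of_int k + 1)) + \<delta>"
proof -
  have W: "weight_sum (\<lambda>_. 1) k = of_int k + 1" "0 < (of_int k + 1 :: real)"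
    using k by (auto simp: weight_sum_one)
  have "F (\<Sum>i=0..k. (1 / (of_int k + 1)) *\<^sub>R x (i + 1))
      \<le> (\<Sum>i=0..k. 1 / (of_int k + 1) * F (x (i + 1)))"
    using k W es by (intro convex_on_sum[OF _ _ F_convex]) (auto simp: estimate_sequence_def)
  then show "F xh \<le> 1 / (of_int k + 1) * (\<Sum>i=0..k. F (x (i + 1)))"
    by (simp add: xh W(1) scaleR_sum_right sum_distrib_left)
  have "(\<Sum>i=0..k. F (x (i + 1))) = (\<Sum>i=0..k. F (z i))"
    using x by (intro sum.cong) auto
  then have "(\<Sum>i=0..k. F (x (i + 1))) - weight_sum (\<lambda>_. 1) k * F xs
      \<le> L / \<sigma> * tangent D G (z k) xs + (of_int k + 1) * \<delta>"
    using minimal_value_gap[OF es] classical_gradient_minimal_value[OF es _ x] k by simp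
  then have "((\<Sum>i=0..k. F (x (i + 1))) - (of_int k + 1) * F xs) / (of_int k + 1)
      \<le> (L / \<sigma> * tangent D G (z k) xs + (of_int k + 1) * \<delta>) / (of_int k + 1)"
    using W by (intro divide_right_mono) auto
  then show "1 / (of_int k + 1) * (\<Sum>i=0..k. F (x (i + 1))) - F xs
      \<le> L * tangent D G (z k) xs / (\<sigma> * (of_int k + 1)) + \<delta>"
    using W(2) by (simp add: diff_divide_distrib add_divide_distrib)
qed

text \<open>The radii increase with k, so the balls around xs with these radii contain all earlier points z,
  and by convexity their weighted means.\<close>

lemma classical_gradient_bounded:
  assumes es: "estimate_sequence Q D G l (\<lambda>_. 1) (\<lambda>_. L / \<sigma>) m z x" and k: "-1 \<le> k"
    and x: "\<And>k. k \<ge> 0 \<Longrightarrow> x k = z (k - 1)"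
    and xh: "k \<ge> 0 \<Longrightarrow> xh = (1 / weight_sum (\<lambda>_. 1) k) *\<^sub>R (\<Sum>i=0..k. 1 *\<^sub>R x (i + 1))"
  defines "R \<equiv> \<lambda>k. {u\<in>Q. (norm (u - xs))\<^sup>2 \<le> 2 * D xs / \<sigma> + 2 * \<delta> / L * (of_int k + 1)}"
  shows "z k \<in> R k \<and> x (k + 1) \<in> R k \<and> (k \<ge> 0 \<longrightarrow> xh \<in> R k)"
proof -
  have zR: "z k \<in> R k" if k: "-1 \<le> k" for k
  proof -
    have zQ: "z i \<in> Q" if "-1 \<le> i" for i
      using es that by (simp add: estimate_sequence_def)
    have "(\<Sum>i=0..k. 1 * F xs) \<le> (\<Sum>i=0..k. F (z i))"
      using xs zQ by (intro sum_mono) auto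
    then have "weight_sum (\<lambda>_. 1) k * F xs \<le> (\<Sum>i=0..k. F (z i))"
      by (simp add: weight_sum_def sum_distrib_right)
    from minimizer_distance[OF es k _ classical_gradient_minimal_value[OF es k x] this]
    show ?thesis
      using zQ k by (simp add: R_def algebra_simps)
  qed
  have mono: "R i \<subseteq> R k" if "i \<le> k" for i
  proof -
    have "2 * \<delta> / L * (of_int i + 1) \<le> 2 * \<delta> / L * (of_int k + 1)"
      using pos that by (intro mult_left_mono) auto
    then show ?thesis
      by (auto simp: R_def)
  qed
  have "xh \<in> R k" if "k \<ge> 0"
    unfolding xh[OF that]
  proof (rule weighted_mean_in_convex)
    show "convex (R k)"
      unfolding R_def by (rule convex_ball_around[OF convex_Q])
    show "x (i + 1) \<in> R k" if "0 \<le> i" "i \<le> k" for i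
      using zR[of i] mono[of i] x[of "i + 1"] that by auto
  qed (use that in \<open>auto simp: weight_sum_one\<close>)
  then show ?thesis
    using zR k x[of "k + 1"] by simp
qed

lemma weight_sum_half:
  "-1 \<le> k \<Longrightarrow> weight_sum (\<lambda>k. (of_int k + 1) / 2) k = (of_int k + 1) * (of_int k + 2) / 4"
proof (induction k rule: int_ge_induct)
  case (step k)
  have "weight_sum (\<lambda>k. (of_int k + 1) / 2) (k + 1)
      = (of_int k + 1) * (of_int k + 2) / 4 + (of_int k + 2) / 2"
    unfolding weight_sum_Suc[OF step(1)] step(2) by simp
  also have "\<dots> = (of_int (k + 1) + 1) * (of_int (k + 1) + 2) / 4"
    by (simp add: field_simps)
  finally show ?case .
qed (simp add: weight_sum_def)

lemma sum_weight_sum_half: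
  "-1 \<le> k \<Longrightarrow> (\<Sum>i=0..k. weight_sum (\<lambda>k. (of_int k + 1) / 2) i)
    = (of_int k + 1) * (of_int k + 2) * (of_int k + 3) / 12"
proof (induction k rule: int_ge_induct)
  case (step k)
  then have "(\<Sum>i=0..k+1. weight_sum (\<lambda>k. (of_int k + 1) / 2) i)
      = (of_int k + 1) * (of_int k + 2) * (of_int k + 3) / 12
        + (of_int (k + 1) + 1) * (of_int (k + 1) + 2) / 4"
    by (simp only: sum_atLeastAtMost_int_Suc weight_sum_half)
  also have "\<dots> = (of_int (k + 1) + 1) * (of_int (k + 1) + 2) * (of_int (k + 1) + 3) / 12"
    by (simp add: field_simps)
  finally show ?case .
qed simp

lemma fast_gradient_half_minimal_value:
  fixes lam defines "lam \<equiv> \<lambda>k. (of_int k + 1) / 2"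
  assumes es: "estimate_sequence Q D G l lam (\<lambda>_. L / \<sigma>) m z x" and k: "-1 \<le> k"
    and x: "\<And>k. k \<ge> -1 \<Longrightarrow> x (k + 1) =
      (1 / weight_sum lam (k + 1)) *\<^sub>R ((\<Sum>i=0..k. lam i *\<^sub>R z i) + lam (k + 1) *\<^sub>R z k)"
    and xh: "\<And>k. k \<ge> 0 \<Longrightarrow> xh k = (1 / weight_sum lam k) *\<^sub>R (\<Sum>i=0..k. lam i *\<^sub>R z i)"
  shows "weight_sum lam k * F (xh k)
    \<le> m k + (of_int k + 1) * (of_int k + 2) * (of_int k + 3) / 12 * \<delta>"
proof -
  have "(lam k)\<^sup>2 \<le> weight_sum lam k" if "k \<ge> 0" for k
    using that unfolding lam_def by (subst weight_sum_half) (auto simp: power2_eq_square)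
  then have "weight_sum lam k * F (xh k) \<le> m k + (\<Sum>i=0..k. weight_sum lam i) * \<delta>"
    using k by (intro fast_gradient_minimal_value[OF es] x xh) (auto simp: lam_def)
  then show ?thesis
    using k unfolding lam_def by (simp add: sum_weight_sum_half)
qed

lemma fast_gradient_rate:
  fixes lam defines "lam \<equiv> \<lambda>k. (of_int k + 1) / 2"
  assumes es: "estimate_sequence Q D G l lam (\<lambda>_. L / \<sigma>) m z x" and k: "0 \<le> k"
    and x: "\<And>k. k \<ge> -1 \<Longrightarrow> x (k + 1) =
      (1 / weight_sum lam (k + 1)) *\<^sub>R ((\<Sum>i=0..k. lam i *\<^sub>R z i) + lam (k + 1) *\<^sub>R z k)"
    and xh: "\<And>k. k \<ge> 0 \<Longrightarrow> xh k = (1 / weight_sum lam k) *\<^sub>R (\<Sum>i=0..k. lam i *\<^sub>R z i)"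
  shows "F (xh k) - F xs \<le> 4 * L * tangent D G (z k) xs / (\<sigma> * (of_int k + 1) * (of_int k + 2))
    + (of_int k + 3) / 3 * \<delta>"
proof -
  let ?r = "of_int k :: real"
  have S: "weight_sum lam k = (?r + 1) * (?r + 2) / 4"
    using k unfolding lam_def by (simp add: weight_sum_half)
  have "weight_sum lam k * F (xh k) - weight_sum lam k * F xs
      \<le> L / \<sigma> * tangent D G (z k) xs + (?r + 1) * (?r + 2) * (?r + 3) / 12 * \<delta>"
  proof (rule minimal_value_gap[OF es])
    show "weight_sum lam k * F (xh k) \<le> m k + (?r + 1) * (?r + 2) * (?r + 3) / 12 * \<delta>"
      using fast_gradient_half_minimal_value[OF es[unfolded lam_def] _ x[unfolded lam_def]
          xh[unfolded lam_def], folded lam_def] k by simp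
  qed (use k in \<open>auto simp: lam_def\<close>)
  also have "\<dots> = (4 * L * tangent D G (z k) xs / (\<sigma> * (?r + 1) * (?r + 2)) + (?r + 3) / 3 * \<delta>)
      * weight_sum lam k"
    using k pos unfolding S by (simp add: divide_simps) (simp add: algebra_simps)
  finally have "(F (xh k) - F xs) * weight_sum lam k
      \<le> (4 * L * tangent D G (z k) xs / (\<sigma> * (?r + 1) * (?r + 2)) + (?r + 3) / 3 * \<delta>)
        * weight_sum lam k"
    by (simp add: algebra_simps)
  moreover have "0 < weight_sum lam k"
    using k by (simp add: S)
  ultimately show ?thesis
    by (rule mult_right_le_imp_le)
qed

lemma fast_gradient_bounded:
  fixes lam defines "lam \<equiv> \<lambda>k. (of_int k + 1) / 2"
  assumes es: "estimate_sequence Q D G l lam (\<lambda>_. L / \<sigma>) m z x" and k: "-1 \<le> k"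
    and x: "\<And>k. k \<ge> -1 \<Longrightarrow> x (k + 1) =
      (1 / weight_sum lam (k + 1)) *\<^sub>R ((\<Sum>i=0..k. lam i *\<^sub>R z i) + lam (k + 1) *\<^sub>R z k)"
    and xh: "\<And>k. k \<ge> 0 \<Longrightarrow> xh k = (1 / weight_sum lam k) *\<^sub>R (\<Sum>i=0..k. lam i *\<^sub>R z i)"
  defines "R \<equiv> \<lambda>k. {u\<in>Q. (norm (u - xs))\<^sup>2
    \<le> 2 * D xs / \<sigma> + \<delta> / (6 * L) * (of_int k + 1) * (of_int k + 2) * (of_int k + 3)}"
  shows "z k \<in> R k \<and> x (k + 1) \<in> R k \<and> (k \<ge> 0 \<longrightarrow> xh k \<in> R k)"
proof -
  have lam: "0 < lam i" if "0 \<le> i" for i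
    using that by (simp add: lam_def)
  have zQ: "z i \<in> Q" if "-1 \<le> i" for i
    using es that by (simp add: estimate_sequence_def)
  have S: "0 < weight_sum lam i" if "0 \<le> i" for i
    using weight_sum_pos[of i lam] that lam by simp
  have xhC: "xh k \<in> C" if "0 \<le> k" "convex C" "\<And>i. 0 \<le> i \<Longrightarrow> i \<le> k \<Longrightarrow> z i \<in> C" for C k
    unfolding xh[OF that(1)] using that lam S by (intro weighted_mean_in_convex) (auto intro: less_imp_le)
  have zR: "z k \<in> R k" if k: "-1 \<le> k" for k
  proof -
    have "weight_sum lam k * F xs \<le> weight_sum lam k * F (xh k)"
    proof (cases "k = -1")
      case False
      then show ?thesis
        using k S[of k] xhC[OF _ convex_Q] zQ xs by (intro mult_left_mono) (auto intro: less_imp_le)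
    qed (simp add: weight_sum_def)
    from minimizer_distance[OF es k _ fast_gradient_half_minimal_value[OF es[unfolded lam_def] k
          x[unfolded lam_def] xh[unfolded lam_def], folded lam_def] this]
    have "(norm (z k - xs))\<^sup>2 \<le> 2 * D xs / \<sigma>
        + 2 * ((of_int k + 1) * (of_int k + 2) * (of_int k + 3) / 12 * \<delta>) / L"
      using lam by (simp add: less_imp_le)
    then show ?thesis
      using zQ k by (simp add: R_def mult_ac)
  qed
  have mono: "R i \<subseteq> R k" if "-1 \<le> i" "i \<le> k" for i
  proof -
    have "\<delta> / (6 * L) * (of_int i + 1) * (of_int i + 2) * (of_int i + 3)
        \<le> \<delta> / (6 * L) * (of_int k + 1) * (of_int k + 2) * (of_int k + 3)"
      using that pos by (intro mult_mono mult_nonneg_nonneg) auto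
    then show ?thesis
      by (auto simp: R_def)
  qed
  have convR: "convex (R k)"
    unfolding R_def by (rule convex_ball_around[OF convex_Q])
  have zRk: "z i \<in> R k" if "-1 \<le> i" "i \<le> k" for i
    using zR mono that by blast
  have xhR: "xh k \<in> R k" if "0 \<le> k"
    using xhC[OF that convR] zRk by simp
  have "x (k + 1) \<in> R k"
    unfolding x[OF k] using k lam zRk convR by (intro test_point_in_convex) auto
  then show ?thesis
    using zR k xhR by blast
qed

end

section \<open>The gradient methods on an extended real-valued problem\<close>

lemma convex_fun_convex_on:
  assumes "convex_fun f" "convex Q" "\<And>u. u \<in> Q \<Longrightarrow> f u = ereal (F u)"
  shows "convex_on Q F"
proof (rule convex_onI)
  fix t :: real and x y assume t: "0 < t" "t < 1" and xy: "x \<in> Q" "y \<in> Q"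
  then have "(1 - t) *\<^sub>R x + t *\<^sub>R y \<in> Q"
    using assms(2) by (auto intro: convexD)
  moreover have "f ((1 - t) *\<^sub>R x + (1 - (1 - t)) *\<^sub>R y)
      \<le> ereal (1 - t) * f x + ereal (1 - (1 - t)) * f y"
    using assms(1)[unfolded convex_fun_def, THEN spec, THEN spec, THEN bspec, of "1 - t"] t by simp
  ultimately show "F ((1 - t) *\<^sub>R x + t *\<^sub>R y) \<le> (1 - t) * F x + t * F y"
    using assms(3) xy by simp
qed (rule assms(2))

text \<open>One method starts from the minimizer of the first auxiliary function, the other from that of the
  prox-function.\<close>

lemma auxiliary_functions_start:
  assumes "auxiliary_functions Q d G lf lam \<beta> \<psi> z x" and "0 < \<beta> (-1)"
    and z: "is_argmin_on Q (\<psi> (-1)) (z (-1)) \<or> is_argmin_on Q d (z (-1))"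
  shows "is_argmin_on Q (\<psi> (-1)) (z (-1))" "is_argmin_on Q d (z (-1))"
proof -
  have "is_argmin_on Q (\<psi> (-1)) (z (-1)) \<and> is_argmin_on Q d (z (-1))"
    using assms(1) unfolding auxiliary_functions_def
  proof
    assume "standard_construction Q d G lf lam \<beta> \<psi> z x"
    then have "is_argmin_on Q (\<psi> (-1)) (z (-1)) \<longleftrightarrow> is_argmin_on Q d (z (-1))"
      using assms(2) by (auto simp: standard_construction_def is_argmin_on_iff ereal_mult_le_mult_iff)
    then show ?thesis
      using z by simp
  next
    assume "property1 Q d G lf lam \<beta> \<psi> z x"
    then show ?thesis
      unfolding property1_def by (metis order_refl)
  qed
  then show "is_argmin_on Q (\<psi> (-1)) (z (-1))" "is_argmin_on Q d (z (-1))"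
    by auto
qed

lemma finite_real_of_ereal:
  "proper_fun g \<Longrightarrow> g u < \<infinity> \<Longrightarrow> g u = ereal (real_of_ereal (g u))"
  by (cases "g u") (auto simp: proper_fun_def)

theorem corollary5p3:
  fixes Q :: "'a::real_normed_vector set"
    and f d :: "'a \<Rightarrow> ereal"
    and G :: "'a \<Rightarrow> ('a \<Rightarrow>\<^sub>L real)"
    and lf :: "'a \<Rightarrow> 'a \<Rightarrow> ereal"
    and \<sigma> L \<delta> :: real
    and x0 xs :: 'a
  assumes finite_dim: "\<exists>B::'a set. finite B \<and> span B = UNIV"
    and Q: "Q \<noteq> {}" "closed Q" "convex Q"
    and f: "proper_fun f" "lsc_fun f" "convex_fun f" "\<forall>x\<in>Q. f x < \<infinity>"
    and xs: "is_argmin_on Q f xs"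
    and d: "proper_fun d" "lsc_fun d" "convex_fun d"
    and d_diff: "continuously_differentiable_on Q d G"
    and d_strong: "\<sigma> > 0" "strongly_convex_on Q \<sigma> d"
    and x0: "is_argmin_on Q d x0" "d x0 = 0"
    and lf: "lower_convex_approximation Q f lf"
    and L_delta: "L > 0" "\<delta> \<ge> 0"
    and f_struct: "\<forall>x\<in>Q. \<forall>y\<in>Q. lf y x \<le> f x \<and>
                   f x \<le> lf y x + ereal (L / 2 * (norm (x - y))\<^sup>2 + \<delta>)"
  shows
    "(\<forall>\<psi> z x xh.
        classical_gradient_method Q d G lf (\<lambda>k. 1) (\<lambda>k. L / \<sigma>) \<psi> z x xh \<longrightarrow>
        (\<forall>k\<ge>0.
           f (xh k) - f xs \<le> ereal (1 / (of_int k + 1)) * (\<Sum>i=0..k. f (x (i + 1))) - f xs \<and>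
           ereal (1 / (of_int k + 1)) * (\<Sum>i=0..k. f (x (i + 1))) - f xs
             \<le> ereal (L * linearization d G (z k) xs / (\<sigma> * (of_int k + 1)) + \<delta>)) \<and>
        (\<forall>k\<ge>-1.
           (let R = {u\<in>Q. (norm (u - xs))\<^sup>2
                        \<le> 2 * real_of_ereal (d xs) / \<sigma> + 2 * \<delta> / L * (of_int k + 1)}
            in z k \<in> R \<and> x (k + 1) \<in> R \<and> (k \<ge> 0 \<longrightarrow> xh k \<in> R))))
     \<and>
     (\<forall>\<psi> z x xh.
        fast_gradient_method Q d G lf (\<lambda>k. (of_int k + 1) / 2) (\<lambda>k. L / \<sigma>) \<psi> z x xh \<longrightarrow>
        (\<forall>k\<ge>0.
           f (xh k) - f xs
             \<le> ereal (4 * L * linearization d G (z k) xs / (\<sigma> * (of_int k + 1) * (of_int k + 2))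
                      + (of_int k + 3) / 3 * \<delta>)) \<and>
        (\<forall>k\<ge>-1.
           (let R = {u\<in>Q. (norm (u - xs))\<^sup>2
                        \<le> 2 * real_of_ereal (d xs) / \<sigma>
                           + \<delta> / (6 * L) * (of_int k + 1) * (of_int k + 2) * (of_int k + 3)}
            in z k \<in> R \<and> x (k + 1) \<in> R \<and> (k \<ge> 0 \<longrightarrow> xh k \<in> R))))"
proof -
  define F where "F u = real_of_ereal (f u)" for u
  define D where "D u = real_of_ereal (d u)" for u
  define l where "l y u = real_of_ereal (lf y u)" for y u
  have fF: "f u = ereal (F u)" if "u \<in> Q" for u
    unfolding F_def using f(1,4) that by (intro finite_real_of_ereal[of f u]) auto
  have dD: "d u = ereal (D u)" if "u \<in> Q" for u
    using d_diff that by (cases "d u") (auto simp: D_def continuously_differentiable_on_def)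
  have lfl: "lf y u = ereal (l y u)" if "y \<in> Q" "u \<in> Q" for y u
    unfolding l_def
  proof (rule finite_real_of_ereal[of "lf y" u])
    show "proper_fun (lf y)"
      using lf that by (simp add: lower_convex_approximation_def)
    have "lf y u \<le> f u"
      using f_struct that by blast
    then show "lf y u < \<infinity>"
      using f(4) that by (auto intro: le_less_trans)
  qed
  have lin: "linearization d G y u = tangent D G y u" for y u
    by (simp add: linearization_def tangent_def D_def)
  have xsQ: "xs \<in> Q"
    using xs by (simp add: is_argmin_on_iff)
  interpret inexact_model Q D G l F \<sigma> L \<delta> xs
  proof
    show "convex_on Q (l y)" if "y \<in> Q" for y
      using convex_fun_convex_on[OF _ Q(3) lfl] lf that by (auto simp: lower_convex_approximation_def)
    show "convex_on Q F"
      using convex_fun_convex_on[OF f(3) Q(3) fF] .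
    show "F xs \<le> F u" if "u \<in> Q" for u
      using xs fF that xsQ by (auto simp: is_argmin_on_iff)
    show "(D has_derivative blinfun_apply (G y)) (at y within Q)" if "y \<in> Q" for y
      using d_diff that by (simp add: continuously_differentiable_on_def D_def[abs_def])
    show "D (t *\<^sub>R u + (1 - t) *\<^sub>R y)
        \<le> t * D u + (1 - t) * D y - \<sigma> / 2 * t * (1 - t) * (norm (u - y))\<^sup>2"
      if "u \<in> Q" "y \<in> Q" "0 \<le> t" "t \<le> 1" for u y t
    proof -
      have "t *\<^sub>R u + (1 - t) *\<^sub>R y \<in> Q"
        using Q(3) that by (auto intro: convexD)
      moreover have "d (t *\<^sub>R u + (1 - t) *\<^sub>R y)
          \<le> ereal t * d u + ereal (1 - t) * d y - ereal (\<sigma> / 2 * t * (1 - t) * (norm (u - y))\<^sup>2)"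
        using d_strong(2) that by (simp add: strongly_convex_on_def)
      ultimately show ?thesis
        using dD that by simp
    qed
    show "l y u \<le> F u" "F u \<le> l y u + (L / 2 * (norm (u - y))\<^sup>2 + \<delta>)" if "y \<in> Q" "u \<in> Q" for y u
    proof -
      have "lf y u \<le> f u" "f u \<le> lf y u + ereal (L / 2 * (norm (u - y))\<^sup>2 + \<delta>)"
        using f_struct that by blast+
      then show "l y u \<le> F u" "F u \<le> l y u + (L / 2 * (norm (u - y))\<^sup>2 + \<delta>)"
        using that by (simp_all add: fF lfl)
    qed
  qed (use Q xsQ d_strong L_delta in auto)
  have zero: "D z = 0" if "is_argmin_on Q d z" for z
  proof -
    have "d z = d x0"
      using that x0(1) by (auto simp: is_argmin_on_iff intro: antisym)
    then show ?thesis
      by (simp add: D_def x0(2))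
  qed
  have \<beta>: "0 < L / \<sigma>"
    using pos by simp
  have cgm: "estimate_sequence Q D G l (\<lambda>_. 1) (\<lambda>_. L / \<sigma>) (\<lambda>k. real_of_ereal (\<psi> k (z k))) z x"
      "\<And>k. k \<ge> 0 \<Longrightarrow> x k = z (k - 1)"
      "\<And>k. k \<ge> 0 \<Longrightarrow> xh k = (1 / weight_sum (\<lambda>_. 1) k) *\<^sub>R (\<Sum>i=0..k. 1 *\<^sub>R x (i + 1))"
    if m: "classical_gradient_method Q d G lf (\<lambda>k. 1) (\<lambda>k. L / \<sigma>) \<psi> z x xh" for \<psi> z x xh
  proof -
    have aux: "auxiliary_functions Q d G lf (\<lambda>k. 1) (\<lambda>k. L / \<sigma>) \<psi> z x"
      and z: "\<And>k. k \<ge> -1 \<Longrightarrow> is_argmin_on Q (\<psi> k) (z k)"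
      and x: "\<And>k. k \<ge> 0 \<Longrightarrow> x k = z (k - 1)"
      using m by (auto simp: classical_gradient_method_def)
    have "D (z (-1)) = 0"
      by (intro zero auxiliary_functions_start[OF aux]) (use \<beta> z in auto)
    moreover have "x k \<in> Q" if "k \<ge> 0" for k
      using x[OF that] z[of "k - 1"] that by (simp add: is_argmin_on_iff)
    ultimately show "estimate_sequence Q D G l (\<lambda>_. 1) (\<lambda>_. L / \<sigma>) (\<lambda>k. real_of_ereal (\<psi> k (z k))) z x"
      using \<beta> by (intro auxiliary_functions_estimate_sequence[OF aux dD lfl z]) auto
    show "x k = z (k - 1)" if "k \<ge> 0" for k
      by (rule x[OF that])
    show "xh k = (1 / weight_sum (\<lambda>_. 1) k) *\<^sub>R (\<Sum>i=0..k. 1 *\<^sub>R x (i + 1))" if "k \<ge> 0" for k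
      using m that by (simp add: classical_gradient_method_def)
  qed
  let ?lam = "\<lambda>k::int. (of_int k + 1) / 2 :: real"
  have fgm: "estimate_sequence Q D G l ?lam (\<lambda>_. L / \<sigma>) (\<lambda>k. real_of_ereal (\<psi> k (z k))) z x"
      "\<And>k. k \<ge> -1 \<Longrightarrow> x (k + 1) =
        (1 / weight_sum ?lam (k + 1)) *\<^sub>R ((\<Sum>i=0..k. ?lam i *\<^sub>R z i) + ?lam (k + 1) *\<^sub>R z k)"
      "\<And>k. k \<ge> 0 \<Longrightarrow> xh k = (1 / weight_sum ?lam k) *\<^sub>R (\<Sum>i=0..k. ?lam i *\<^sub>R z i)"
    if m: "fast_gradient_method Q d G lf ?lam (\<lambda>k. L / \<sigma>) \<psi> z x xh" for \<psi> z x xh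
  proof -
    note m' = m[unfolded fast_gradient_method_def]
    have aux: "auxiliary_functions Q d G lf ?lam (\<lambda>k. L / \<sigma>) \<psi> z x"
      and start: "is_argmin_on Q d (z (-1))"
      using m' by blast+
    have z: "is_argmin_on Q (\<psi> k) (z k)" if "k \<ge> -1" for k
    proof -
      consider "k = -1" | "k = 0" | "k - 1 \<ge> 0" using \<open>k \<ge> -1\<close> by linarith
      then show ?thesis
      proof cases
        case 1
        then show ?thesis
          using auxiliary_functions_start(1)[OF aux] \<beta> start by simp
      next
        case 3
        have "is_argmin_on Q (\<psi> ((k - 1) + 1)) (z ((k - 1) + 1))"
          using m' 3 by blast
        then show ?thesis
          by simp
      qed (use m' in auto)
    qed
    show x: "x (k + 1) =
        (1 / weight_sum ?lam (k + 1)) *\<^sub>R ((\<Sum>i=0..k. ?lam i *\<^sub>R z i) + ?lam (k + 1) *\<^sub>R z k)"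
      if "k \<ge> -1" for k
    proof (cases "k = -1")
      case True
      then show ?thesis
        using m' by (simp add: weight_sum_def)
    next
      case False
      then show ?thesis
        using m' that by auto
    qed
    show "xh k = (1 / weight_sum ?lam k) *\<^sub>R (\<Sum>i=0..k. ?lam i *\<^sub>R z i)" if "k \<ge> 0" for k
    proof (cases "k = 0")
      case True
      then show ?thesis
        using m' by (simp add: weight_sum_def)
    next
      case False
      then have "xh ((k - 1) + 1)
          = (1 / weight_sum ?lam ((k - 1) + 1)) *\<^sub>R (\<Sum>i=0..(k - 1) + 1. ?lam i *\<^sub>R z i)"
        using m' that by (smt (verit))
      then show ?thesis
        by simp
    qed
    have "x k \<in> Q" if "k \<ge> 0" for k
    proof -
      have k: "k - 1 \<ge> -1"
        using that by simp
      have "x ((k - 1) + 1) \<in> Q"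
        unfolding x[of "k - 1", OF k]
        using k z by (intro test_point_in_convex Q(3)) (auto simp: is_argmin_on_iff)
      then show ?thesis
        by simp
    qed
    then show "estimate_sequence Q D G l ?lam (\<lambda>_. L / \<sigma>) (\<lambda>k. real_of_ereal (\<psi> k (z k))) z x"
      using \<beta> zero[OF start] by (intro auxiliary_functions_estimate_sequence[OF aux dD lfl z]) auto
  qed
  have Dxs: "real_of_ereal (d xs) = D xs"
    by (simp add: D_def)
  show ?thesis
  proof (intro conjI allI impI)
    fix \<psi> :: "int \<Rightarrow> 'a \<Rightarrow> ereal" and z x xh :: "int \<Rightarrow> 'a" and k :: int
    assume m: "classical_gradient_method Q d G lf (\<lambda>k. 1) (\<lambda>k. L / \<sigma>) \<psi> z x xh"
    note bounded = classical_gradient_bounded[OF cgm(1)[OF m] _ cgm(2)[OF m] cgm(3)[OF m]]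
    {
      assume k: "k \<ge> 0"
      have "x (i + 1) \<in> Q" if "i \<ge> 0" for i
        using cgm(1)[OF m] that by (simp add: estimate_sequence_def)
      then have "(\<Sum>i=0..k. f (x (i + 1))) = (\<Sum>i=0..k. ereal (F (x (i + 1))))"
        by (intro sum.cong) (auto simp: fF)
      then have sum: "(\<Sum>i=0..k. f (x (i + 1))) = ereal (\<Sum>i=0..k. F (x (i + 1)))"
        by simp
      have "xh k \<in> Q"
        using bounded[of k] k by simp
      note rate = classical_gradient_rate[OF cgm(1)[OF m] k cgm(2)[OF m] cgm(3)[OF m k]]
      show "f (xh k) - f xs \<le> ereal (1 / (of_int k + 1)) * (\<Sum>i=0..k. f (x (i + 1))) - f xs"
        using rate(1) \<open>xh k \<in> Q\<close> xsQ by (simp add: sum fF)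
      show "ereal (1 / (of_int k + 1)) * (\<Sum>i=0..k. f (x (i + 1))) - f xs
          \<le> ereal (L * linearization d G (z k) xs / (\<sigma> * (of_int k + 1)) + \<delta>)"
        using rate(2) xsQ by (simp add: sum fF lin)
    }
    show "let R = {u\<in>Q. (norm (u - xs))\<^sup>2
          \<le> 2 * real_of_ereal (d xs) / \<sigma> + 2 * \<delta> / L * (of_int k + 1)}
        in z k \<in> R \<and> x (k + 1) \<in> R \<and> (k \<ge> 0 \<longrightarrow> xh k \<in> R)" if "k \<ge> -1"
      unfolding Let_def Dxs by (rule bounded[OF that])
  next
    fix \<psi> :: "int \<Rightarrow> 'a \<Rightarrow> ereal" and z x xh :: "int \<Rightarrow> 'a" and k :: int
    assume m: "fast_gradient_method Q d G lf ?lam (\<lambda>k. L / \<sigma>) \<psi> z x xh"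
    note bounded = fast_gradient_bounded[OF fgm(1)[OF m] _ fgm(2)[OF m] fgm(3)[OF m]]
    show "f (xh k) - f xs
        \<le> ereal (4 * L * linearization d G (z k) xs / (\<sigma> * (of_int k + 1) * (of_int k + 2))
            + (of_int k + 3) / 3 * \<delta>)" if k: "k \<ge> 0"
    proof -
      have "xh k \<in> Q"
        using bounded[of k] k by simp
      then show ?thesis
        using fast_gradient_rate[OF fgm(1)[OF m] k fgm(2)[OF m] fgm(3)[OF m]] xsQ
        by (simp add: fF lin)
    qed
    show "let R = {u\<in>Q. (norm (u - xs))\<^sup>2 \<le> 2 * real_of_ereal (d xs) / \<sigma>
          + \<delta> / (6 * L) * (of_int k + 1) * (of_int k + 2) * (of_int k + 3)}
        in z k \<in> R \<and> x (k + 1) \<in> R \<and> (k \<ge> 0 \<longrightarrow> xh k \<in> R)" if "k \<ge> -1"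
      unfolding Let_def Dxs by (rule bounded[OF that])
  qed
qed

end
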